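(* Let $A$ be a local commutative principal ideal ring whose residue field is finite with $q$ elements. Then there exist polynomials $p_1$ and $p_2$ with real coefficients, taking positive values at all positive integers, such that for every positive integer $k$ not exceeding the length of $A$, \[ p_1(k)\,q^{\lfloor k/3\rfloor}<|B\backslash GL_3(A_k)/B|<p_2(k)\,q^{\lceil k/3\rceil}, \] where $A_k=A/\wp^k$ and $B$ is the subgroup of upper triangular matrices in $GL_3(A_k)$.
   Context: $\wp=(\pi)$ denotes the maximal ideal of $A$. The length of $A$ is the least positive integer $m$ with $\wp^m=0$, and is $\infty$ if there is no such $m$ (in which case all positive integers $k$ are allowed). *)

theory Defs
  imports
    "HOL-Algebra.Algebra"
    "HOL-Computational_Algebra.Polynomial"
    "HOL-Library.Extended_Nat"
begin

(* Zero divisors are allowed. The zero ring is excluded, as it has no maximal ideal. *)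
locale local_principal_ideal_ring = cring A for A (structure) +
  assumes unique_maximalideal: "\<exists>!M. maximalideal M A"
    and all_ideals_principal: "\<And>I. ideal I A \<Longrightarrow> principalideal I A"

definition max_ideal :: "('a, 'm) ring_scheme \<Rightarrow> 'a set"
  where "max_ideal A = (THE M. maximalideal M A)"

(* Powers in the semiring of ideals are powers with respect to the ideal product. *)
definition max_ideal_power :: "('a, 'm) ring_scheme \<Rightarrow> nat \<Rightarrow> 'a set"
  where "max_ideal_power A k = max_ideal A [^]\<^bsub>ideals_set A\<^esub> k"

definition local_ring_length :: "('a, 'm) ring_scheme \<Rightarrow> enat"
  where "local_ring_length A =
    (if \<exists>m>0. max_ideal_power A m = {\<zero>\<^bsub>A\<^esub>}
     then enat (LEAST m. m > 0 \<and> max_ideal_power A m = {\<zero>\<^bsub>A\<^esub>})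
     else \<infinity>)"

(* Matrices are functions on index pairs (row, column), with indices counted from 0,
   that are undefined outside the index range. *)
definition mat_monoid :: "nat \<Rightarrow> ('a, 'm) ring_scheme \<Rightarrow> (nat \<times> nat \<Rightarrow> 'a) monoid"
  where "mat_monoid n R =
    \<lparr> carrier = ({..<n} \<times> {..<n}) \<rightarrow>\<^sub>E carrier R,
      monoid.mult = (\<lambda>M N. restrict (\<lambda>(i, j). \<Oplus>\<^bsub>R\<^esub>l\<in>{..<n}. M (i, l) \<otimes>\<^bsub>R\<^esub> N (l, j)) ({..<n} \<times> {..<n})),
      one = restrict (\<lambda>(i, j). if i = j then \<one>\<^bsub>R\<^esub> else \<zero>\<^bsub>R\<^esub>) ({..<n} \<times> {..<n}) \<rparr>"

definition GL :: "nat \<Rightarrow> ('a, 'm) ring_scheme \<Rightarrow> (nat \<times> nat \<Rightarrow> 'a) monoid"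
  where "GL n R = units_of (mat_monoid n R)"

definition upper_triangular_GL :: "nat \<Rightarrow> ('a, 'm) ring_scheme \<Rightarrow> (nat \<times> nat \<Rightarrow> 'a) set"
  where "upper_triangular_GL n R =
    {M \<in> carrier (GL n R). \<forall>i<n. \<forall>j<i. M (i, j) = \<zero>\<^bsub>R\<^esub>}"

definition double_cosets :: "('g, 'm) monoid_scheme \<Rightarrow> 'g set \<Rightarrow> 'g set \<Rightarrow> 'g set set"
  where "double_cosets G H K = {(H #>\<^bsub>G\<^esub> g) <#>\<^bsub>G\<^esub> K | g. g \<in> carrier G}"

end

theory Submission
  imports Defs
begin

text \<open>Each quotient is a finite chain ring: every element is a unit times a power of \<open>p\<close>. Gaussian
  elimination by upper triangular matrices brings an invertible matrix either to one of five forms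
  with at most two entries that are proper powers of \<open>p\<close>, or to a lower unipotent matrix with
  entries \<open>a\<^sub>2\<^sub>1\<close>, \<open>a\<^sub>3\<^sub>2\<close>, \<open>a\<^sub>3\<^sub>1\<close>. In the latter case let \<open>\<alpha>\<close>, \<open>\<beta>\<close> be the valuations of
  \<open>a\<^sub>2\<^sub>1\<close>, \<open>a\<^sub>3\<^sub>2\<close>. By symmetry \<open>\<beta> \<le> \<alpha>\<close>; then either \<open>a\<^sub>2\<^sub>1\<close> can be cleared, or the matrix can be scaled to
  entries \<open>p\<^sup>\<alpha>\<close>, \<open>p\<^sup>\<beta>\<close>, \<open>p\<^sup>\<alpha> e\<close>. With \<open>i\<close> and \<open>j\<close> the valuations of \<open>e\<close> and \<open>p\<^sup>\<beta> - e\<close>, the parameter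
  \<open>e\<close> lies in a fixed coset of the ideal generated by \<open>p\<close> to the power \<open>max i j\<close> and matters only modulo \<open>p\<close> to the
  powers \<open>i + j\<close> and \<open>k - \<alpha>\<close>. Hence it takes at most \<open>q\<close> to the power
  \<open>min (min i j) (k - \<alpha> - max i j)\<close> values, an exponent that is at most \<open>k / 3\<close>. The family with entries
  \<open>p\<^sup>n\<close>, \<open>u p\<^sup>n\<close>, \<open>p\<^sup>n p\<^sup>n\<close> for \<open>n = k div 3\<close> gives the lower bound.\<close>

section \<open>Finite chain rings\<close>

locale finite_chain_ring = cring R for R (structure) +
  fixes p :: 'a and k :: nat and T :: "'a set"
  assumes p_closed [simp, intro]: "p \<in> carrier R"
    and k_pos: "0 < k"
    and p_pow_k: "p [^] k = \<zero>"
    and p_pow_nonzero: "j < k \<Longrightarrow> p [^] j \<noteq> \<zero>"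
    and unit_times_power: "x \<in> carrier R \<Longrightarrow> \<exists>u\<in>Units R. \<exists>i\<le>k. x = u \<otimes> p [^] i"
    and T_finite: "finite T" and T_closed: "T \<subseteq> carrier R"
    and T_cover: "x \<in> carrier R \<Longrightarrow> \<exists>t\<in>T. \<exists>z\<in>carrier R. x = t \<oplus> p \<otimes> z"
    and T_unique: "\<lbrakk>s \<in> T; t \<in> T; z \<in> carrier R; s = t \<oplus> p \<otimes> z\<rbrakk> \<Longrightarrow> s = t"
begin

lemma pow_split: "(i::nat) \<le> j \<Longrightarrow> p [^] j = p [^] i \<otimes> p [^] (j - i)"
  by (simp add: nat_pow_mult)

lemma p_pow_large: "k \<le> j \<Longrightarrow> p [^] j = \<zero>"
  using pow_split[of k j] p_pow_k by simp

lemma one_not_multiple: "z \<in> carrier R \<Longrightarrow> \<one> \<noteq> p \<otimes> z"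
proof
  assume z: "z \<in> carrier R" and e: "\<one> = p \<otimes> z"
  have "p [^] (k - 1) = p [^] (k - 1) \<otimes> (p \<otimes> z)"
    using e z by (metis nat_pow_closed p_closed r_one)
  also have "\<dots> = p [^] k \<otimes> z"
    using k_pos z by (cases k) (simp_all add: m_assoc)
  finally show False
    using p_pow_k z p_pow_nonzero[of "k - 1"] k_pos by simp
qed

lemma unit_or_multiple:
  assumes "x \<in> carrier R"
  obtains "x \<in> Units R" | z where "z \<in> carrier R" "x = p \<otimes> z"
proof -
  obtain u i where u: "u \<in> Units R" "i \<le> k" "x = u \<otimes> p [^] i"
    using unit_times_power[OF assms] by blast
  show thesis
  proof (cases i)
    case 0
    with u show ?thesis by (intro that(1)) auto
  next
    case (Suc j)
    then have "x = p \<otimes> (u \<otimes> p [^] j)"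
      using u(1,3) by (metis Units_closed m_assoc m_comm m_lcomm nat_pow_Suc nat_pow_closed p_closed)
    with u show ?thesis
      by (intro that(2)[of "u \<otimes> p [^] j"]) auto
  qed
qed

lemma unit_not_multiple: "x \<in> Units R \<Longrightarrow> z \<in> carrier R \<Longrightarrow> x \<noteq> p \<otimes> z"
proof
  assume a: "x \<in> Units R" "z \<in> carrier R" "x = p \<otimes> z"
  have "\<one> = x \<otimes> inv x" using a(1) by simp
  then have "\<one> = p \<otimes> (z \<otimes> inv x)" using a by (metis Units_inv_closed m_assoc p_closed)
  then show False using one_not_multiple[of "z \<otimes> inv x"] a by simp
qed

lemma unit_plus_multiple:
  assumes "u \<in> Units R" "z \<in> carrier R"
  shows "u \<oplus> p \<otimes> z \<in> Units R"
proof (rule unit_or_multiple[of "u \<oplus> p \<otimes> z"])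
  fix w assume w: "w \<in> carrier R" "u \<oplus> p \<otimes> z = p \<otimes> w"
  have uc: "u \<in> carrier R" using assms by auto
  have "u = (u \<oplus> p \<otimes> z) \<ominus> p \<otimes> z"
    using uc assms(2) p_closed by algebra
  also have "\<dots> = p \<otimes> (w \<ominus> z)"
    unfolding w(2) using w(1) assms(2) p_closed by algebra
  finally show ?thesis
    using unit_not_multiple[OF assms(1), of "w \<ominus> z"] w assms by simp
qed (use assms in auto)

lemma unit_mult_eq_zero:
  assumes "a \<in> carrier R" "v \<in> Units R" "a \<otimes> v = \<zero>"
  shows "a = \<zero>"
proof -
  have v: "v \<in> carrier R" "inv v \<in> carrier R" using assms by auto
  have "a = a \<otimes> (v \<otimes> inv v)" using assms by simp
  also have "\<dots> = (a \<otimes> v) \<otimes> inv v" using assms(1) v by algebra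
  finally show ?thesis using assms v by simp
qed

lemma pow_cancel:
  assumes x: "x \<in> carrier R" and y: "y \<in> carrier R" and le: "i \<le> j" "j \<le> k"
    and e: "p [^] i \<otimes> x = p [^] j \<otimes> y"
  shows "\<exists>z\<in>carrier R. x = p [^] (j - i) \<otimes> z"
proof -
  obtain u l where u: "u \<in> Units R" "l \<le> k" "x = u \<otimes> p [^] l"
    using unit_times_power[OF x] by blast
  have uc: "u \<in> carrier R" "inv u \<in> carrier R" using u by auto
  show ?thesis
  proof (cases "j - i \<le> l")
    case True
    define a b where "a = p [^] (j - i)" and "b = p [^] (l - (j - i))"
    have ab: "a \<in> carrier R" "b \<in> carrier R" by (auto simp: a_def b_def)
    have "x = u \<otimes> (a \<otimes> b)"
      unfolding u(3) a_def b_def pow_split[OF True] by (rule refl)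
    also have "\<dots> = a \<otimes> (u \<otimes> b)" using ab uc by algebra
    finally show ?thesis unfolding a_def[symmetric] using ab uc by (intro bexI[of _ "u \<otimes> b"]) auto
  next
    case False
    then obtain m where m: "j = (i + l) + Suc m"
      by (metis add.commute less_imp_Suc_add linorder_not_le add_Suc_right less_diff_conv)
    define a b r where "a = p [^] (i + l)" and "b = p [^] m" and "r = inv u \<otimes> y"
    have c: "a \<in> carrier R" "b \<in> carrier R" "r \<in> carrier R" "p [^] i \<in> carrier R" "p [^] l \<in> carrier R"
      using uc y by (auto simp: a_def b_def r_def)
    have uu: "u \<otimes> inv u = \<one>" using u by simp
    have "a = p [^] i \<otimes> p [^] l" by (simp add: a_def nat_pow_mult)
    also have "\<dots> = p [^] i \<otimes> p [^] l \<otimes> (u \<otimes> inv u)" using c uu by simp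
    also have "\<dots> = inv u \<otimes> (p [^] i \<otimes> (u \<otimes> p [^] l))" using c uc by algebra
    also have "\<dots> = inv u \<otimes> (p [^] j \<otimes> y)" using e u(3) by simp
    also have "p [^] j = a \<otimes> (b \<otimes> p)" by (simp add: a_def b_def m nat_pow_mult[symmetric] m_assoc)
    also have "inv u \<otimes> (a \<otimes> (b \<otimes> p) \<otimes> y) = a \<otimes> (b \<otimes> p) \<otimes> r"
      unfolding r_def using c y uc p_closed by algebra
    finally have q: "a = a \<otimes> (b \<otimes> p) \<otimes> r" .
    have unit: "\<one> \<oplus> p \<otimes> (\<ominus> (b \<otimes> r)) \<in> Units R"
      using c by (intro unit_plus_multiple) auto
    have "a \<otimes> (\<one> \<oplus> p \<otimes> (\<ominus> (b \<otimes> r))) = a \<ominus> a \<otimes> (b \<otimes> p) \<otimes> r"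
      using c p_closed by algebra
    also have "\<dots> = \<zero>" unfolding q[symmetric] using c by (simp add: minus_eq r_neg)
    finally have "a = \<zero>" using unit_mult_eq_zero[OF c(1) unit] by simp
    then show ?thesis using p_pow_nonzero[of "i + l"] m le unfolding a_def by simp
  qed
qed

primrec T_mod :: "nat \<Rightarrow> 'a set" where
  "T_mod 0 = {\<zero>}"
| "T_mod (Suc n) = (\<lambda>(t, s). t \<oplus> p \<otimes> s) ` (T \<times> T_mod n)"

lemma T_mod_closed: "T_mod n \<subseteq> carrier R"
  using T_closed by (induction n) auto

lemma T_mod_finite: "finite (T_mod n)"
  using T_finite by (induction n) auto

lemma card_T_mod_le: "card (T_mod n) \<le> card T ^ n"
proof (induction n)
  case (Suc n)
  have "card (T_mod (Suc n)) \<le> card (T \<times> T_mod n)"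
    unfolding T_mod.simps using T_finite T_mod_finite by (intro card_image_le) simp
  also have "\<dots> \<le> card T ^ Suc n"
    using Suc by (simp add: card_cartesian_product)
  finally show ?case .
qed auto

lemma T_mod_cover: "x \<in> carrier R \<Longrightarrow> \<exists>t\<in>T_mod n. \<exists>z\<in>carrier R. x = t \<oplus> p [^] n \<otimes> z"
proof (induction n arbitrary: x)
  case (Suc n)
  obtain t y where t: "t \<in> T" "y \<in> carrier R" "x = t \<oplus> p \<otimes> y"
    using T_cover[OF Suc.prems] by blast
  obtain s z where s: "s \<in> T_mod n" "z \<in> carrier R" "y = s \<oplus> p [^] n \<otimes> z"
    using Suc.IH[OF t(2)] by blast
  have c: "t \<in> carrier R" "s \<in> carrier R" using t s T_closed T_mod_closed by auto
  have "x = (t \<oplus> p \<otimes> s) \<oplus> p [^] Suc n \<otimes> z"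
  proof -
    define b where "b = p [^] n"
    have "b \<in> carrier R" by (simp add: b_def)
    then show ?thesis unfolding t s nat_pow_Suc b_def[symmetric] using c s p_closed by algebra
  qed
  moreover have "t \<oplus> p \<otimes> s \<in> T_mod (Suc n)" using t s by auto
  ultimately show ?case using s by blast
qed auto

lemma T_mod_unique:
  "\<lbrakk>n \<le> k; s \<in> T_mod n; t \<in> T_mod n; z \<in> carrier R; s = t \<oplus> p [^] n \<otimes> z\<rbrakk> \<Longrightarrow> s = t"
proof (induction n arbitrary: s t z)
  case (Suc n)
  obtain s1 s2 where s: "s1 \<in> T" "s2 \<in> T_mod n" "s = s1 \<oplus> p \<otimes> s2" using Suc.prems by auto
  obtain t1 t2 where t: "t1 \<in> T" "t2 \<in> T_mod n" "t = t1 \<oplus> p \<otimes> t2" using Suc.prems by auto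
  have c: "s1 \<in> carrier R" "t1 \<in> carrier R" "s2 \<in> carrier R" "t2 \<in> carrier R"
    "z \<in> carrier R" "p [^] n \<in> carrier R"
    using s t T_closed T_mod_closed Suc.prems by auto
  have e: "s1 \<oplus> p \<otimes> s2 = t1 \<oplus> p \<otimes> t2 \<oplus> p \<otimes> (p [^] n \<otimes> z)"
    using Suc.prems s t c by (simp add: m_ac)
  have "s1 = (s1 \<oplus> p \<otimes> s2) \<ominus> p \<otimes> s2" using c p_closed by algebra
  also have "\<dots> = t1 \<oplus> p \<otimes> (t2 \<oplus> p [^] n \<otimes> z \<ominus> s2)"
    unfolding e using c p_closed by algebra
  finally have 1: "s1 = t1" by (rule T_unique[rotated 3]) (use s t c in auto)
  have "p \<otimes> (s2 \<ominus> t2) = (s1 \<oplus> p \<otimes> s2) \<ominus> s1 \<ominus> p \<otimes> t2" using c p_closed by algebra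
  also have "\<dots> = p \<otimes> (p [^] n \<otimes> z)" unfolding e unfolding 1 using c p_closed by algebra
  finally have "p [^] (1::nat) \<otimes> (s2 \<ominus> t2) = p [^] Suc n \<otimes> z" using c by (simp add: m_ac)
  from pow_cancel[OF _ _ _ _ this] obtain y where y: "y \<in> carrier R" "s2 \<ominus> t2 = p [^] n \<otimes> y"
    using c Suc.prems by auto
  have "s2 = t2 \<oplus> (s2 \<ominus> t2)" using c by algebra
  then have "s2 = t2" using Suc.IH[of s2 t2 y] y s t Suc.prems by simp
  then show ?case using 1 s t by simp
qed auto

lemma card_T_mod: "n \<le> k \<Longrightarrow> card (T_mod n) = card T ^ n"
proof (induction n)
  case (Suc n)
  have "inj_on (\<lambda>(t, s). t \<oplus> p \<otimes> s) (T \<times> T_mod n)"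
  proof (rule inj_onI, clarify)
    fix s1 s2 t1 t2
    assume a: "s1 \<in> T" "s2 \<in> T_mod n" "t1 \<in> T" "t2 \<in> T_mod n"
      and e: "s1 \<oplus> p \<otimes> s2 = t1 \<oplus> p \<otimes> t2"
    have c: "s1 \<in> carrier R" "t1 \<in> carrier R" "s2 \<in> carrier R" "t2 \<in> carrier R"
      using a T_closed T_mod_closed by auto
    have "s1 = (s1 \<oplus> p \<otimes> s2) \<ominus> p \<otimes> s2" using c p_closed by algebra
    also have "\<dots> = t1 \<oplus> p \<otimes> (t2 \<ominus> s2)" unfolding e using c p_closed by algebra
    finally have 1: "s1 = t1" by (rule T_unique[rotated 3]) (use a c in auto)
    have "p \<otimes> (s2 \<ominus> t2) = (s1 \<oplus> p \<otimes> s2) \<ominus> s1 \<ominus> p \<otimes> t2" using c p_closed by algebra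
    also have "\<dots> = \<zero>" unfolding e unfolding 1 using c p_closed by algebra
    finally have "p [^] (1::nat) \<otimes> (s2 \<ominus> t2) = p [^] Suc n \<otimes> \<zero> \<oplus> \<zero>" using c by simp
    then obtain y where y: "y \<in> carrier R" "s2 \<ominus> t2 = p [^] n \<otimes> y"
      using pow_cancel[of "s2 \<ominus> t2" \<zero> 1 "Suc n"] c Suc.prems by auto
    have "s2 = t2 \<oplus> (s2 \<ominus> t2)" using c by algebra
    then have "s2 = t2" using T_mod_unique[of n s2 t2 y] y a Suc.prems by simp
    with 1 show "s1 = t1 \<and> s2 = t2" by simp
  qed
  then show ?case using Suc by (simp add: card_image card_cartesian_product)
qed auto

end

section \<open>Invertible matrices of size three and their double cosets\<close>

definition M3 :: "'a \<Rightarrow> 'a \<Rightarrow> 'a \<Rightarrow> 'a \<Rightarrow> 'a \<Rightarrow> 'a \<Rightarrow> 'a \<Rightarrow> 'a \<Rightarrow> 'a \<Rightarrow> nat \<times> nat \<Rightarrow> 'a"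
  where "M3 a b c d e f g h i =
    restrict (\<lambda>(r, s). [[a, b, c], [d, e, f], [g, h, i]] ! r ! s) ({..<3} \<times> {..<3})"

lemma M3_entry [simp]:
  "M3 a b c d e f g h i (0, 0) = a" "M3 a b c d e f g h i (0, Suc 0) = b" "M3 a b c d e f g h i (0, 2) = c"
  "M3 a b c d e f g h i (Suc 0, 0) = d" "M3 a b c d e f g h i (Suc 0, Suc 0) = e" "M3 a b c d e f g h i (Suc 0, 2) = f"
  "M3 a b c d e f g h i (2, 0) = g" "M3 a b c d e f g h i (2, Suc 0) = h" "M3 a b c d e f g h i (2, 2) = i"
  by (simp_all add: M3_def)

lemma less_3_iff: "(n::nat) < 3 \<longleftrightarrow> n = 0 \<or> n = Suc 0 \<or> n = 2"
  by auto

lemma eq_M3I: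
  assumes "M \<in> ({..<3} \<times> {..<3}) \<rightarrow>\<^sub>E C"
    "M (0, 0) = a" "M (0, Suc 0) = b" "M (0, 2) = c"
    "M (Suc 0, 0) = d" "M (Suc 0, Suc 0) = e" "M (Suc 0, 2) = f"
    "M (2, 0) = g" "M (2, Suc 0) = h" "M (2, 2) = i"
  shows "M = M3 a b c d e f g h i"
proof
  fix x
  show "M x = M3 a b c d e f g h i x"
  proof (cases "x \<in> {..<3} \<times> {..<3}")
    case True
    then show ?thesis using assms(2-) by (auto simp: less_3_iff)
  next
    case False
    then show ?thesis using PiE_arb[OF assms(1)] unfolding M3_def by simp
  qed
qed

lemma M3_eq_iff:
  "M3 a b c d e f g h i = M3 a' b' c' d' e' f' g' h' i' \<longleftrightarrow>
    a = a' \<and> b = b' \<and> c = c' \<and> d = d' \<and> e = e' \<and> f = f' \<and> g = g' \<and> h = h' \<and> i = i'"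
  by (metis M3_entry)

lemma M3_in_PiE:
  "M3 a b c d e f g h i \<in> ({..<3} \<times> {..<3}) \<rightarrow>\<^sub>E C \<longleftrightarrow> {a, b, c, d, e, f, g, h, i} \<subseteq> C"
proof
  assume "M3 a b c d e f g h i \<in> ({..<3} \<times> {..<3}) \<rightarrow>\<^sub>E C"
  from PiE_mem[OF this] have *: "\<And>r s. r < 3 \<Longrightarrow> s < 3 \<Longrightarrow> M3 a b c d e f g h i (r, s) \<in> C" by simp
  show "{a, b, c, d, e, f, g, h, i} \<subseteq> C"
    using *[of 0 0] *[of 0 "Suc 0"] *[of 0 2] *[of "Suc 0" 0] *[of "Suc 0" "Suc 0"] *[of "Suc 0" 2]
      *[of 2 0] *[of 2 "Suc 0"] *[of 2 2] by simp
next
  assume C: "{a, b, c, d, e, f, g, h, i} \<subseteq> C"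
  show "M3 a b c d e f g h i \<in> ({..<3} \<times> {..<3}) \<rightarrow>\<^sub>E C"
  proof (rule PiE_I)
    fix x :: "nat \<times> nat" assume "x \<in> {..<3} \<times> {..<3}"
    with C show "M3 a b c d e f g h i x \<in> C" by (auto simp: less_3_iff)
  next
    fix x :: "nat \<times> nat" assume "x \<notin> {..<3} \<times> {..<3}"
    then show "M3 a b c d e f g h i x = undefined" unfolding M3_def by simp
  qed
qed

lemma M3_cases:
  assumes "M \<in> ({..<3} \<times> {..<3}) \<rightarrow>\<^sub>E C"
  obtains a b c d e f g h i where "{a, b, c, d, e, f, g, h, i} \<subseteq> C" "M = M3 a b c d e f g h i"
  by (metis assms eq_M3I M3_in_PiE)

context cring
begin

lemma carrier_mat3 [simp]: "M3 a b c d e f g h i \<in> carrier (mat_monoid 3 R) \<longleftrightarrow> {a, b, c, d, e, f, g, h, i} \<subseteq> carrier R"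
  by (simp only: mat_monoid_def partial_object.simps M3_in_PiE)

lemma mat3_cases:
  assumes "M \<in> carrier (mat_monoid 3 R)"
  obtains a b c d e f g h i where "{a, b, c, d, e, f, g, h, i} \<subseteq> carrier R" "M = M3 a b c d e f g h i"
proof -
  have "M \<in> ({..<3} \<times> {..<3}) \<rightarrow>\<^sub>E carrier R" using assms by (simp add: mat_monoid_def)
  from M3_cases[OF this that] show thesis .
qed

lemma finsum_3:
  assumes "f 0 \<in> carrier R" "f (Suc 0) \<in> carrier R" "f 2 \<in> carrier R"
  shows "(\<Oplus>l\<in>{..<3::nat}. f l) = f 0 \<oplus> f (Suc 0) \<oplus> f 2"
proof -
  have "{..<3::nat} = {2, Suc 0, 0}" by auto
  then show ?thesis using assms by (simp add: a_ac)
qed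

lemma mat3_mult:
  assumes "{a, b, c, d, e, f, g, h, i} \<subseteq> carrier R" "{a', b', c', d', e', f', g', h', i'} \<subseteq> carrier R"
  shows "M3 a b c d e f g h i \<otimes>\<^bsub>mat_monoid 3 R\<^esub> M3 a' b' c' d' e' f' g' h' i' =
    M3 (a \<otimes> a' \<oplus> b \<otimes> d' \<oplus> c \<otimes> g') (a \<otimes> b' \<oplus> b \<otimes> e' \<oplus> c \<otimes> h') (a \<otimes> c' \<oplus> b \<otimes> f' \<oplus> c \<otimes> i')
       (d \<otimes> a' \<oplus> e \<otimes> d' \<oplus> f \<otimes> g') (d \<otimes> b' \<oplus> e \<otimes> e' \<oplus> f \<otimes> h') (d \<otimes> c' \<oplus> e \<otimes> f' \<oplus> f \<otimes> i')
       (g \<otimes> a' \<oplus> h \<otimes> d' \<oplus> i \<otimes> g') (g \<otimes> b' \<oplus> h \<otimes> e' \<oplus> i \<otimes> h') (g \<otimes> c' \<oplus> h \<otimes> f' \<oplus> i \<otimes> i')"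
    (is "?X = M3 ?a ?b ?c ?d ?e ?f ?g ?h ?i")
proof (rule eq_M3I)
  have entry: "?X (r, s) = (\<Oplus>l\<in>{..<3}. M3 a b c d e f g h i (r, l) \<otimes> M3 a' b' c' d' e' f' g' h' i' (l, s))"
    if "r < 3" "s < 3" for r s
    using that by (simp add: mat_monoid_def)
  show "?X (0, 0) = ?a" "?X (0, Suc 0) = ?b" "?X (0, 2) = ?c"
    "?X (Suc 0, 0) = ?d" "?X (Suc 0, Suc 0) = ?e" "?X (Suc 0, 2) = ?f"
    "?X (2, 0) = ?g" "?X (2, Suc 0) = ?h" "?X (2, 2) = ?i"
    using assms by (simp_all add: entry finsum_3)
  show "?X \<in> ({..<3} \<times> {..<3}) \<rightarrow>\<^sub>E UNIV"
    by (auto simp: mat_monoid_def)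
qed

lemma mat3_one: "\<one>\<^bsub>mat_monoid 3 R\<^esub> = M3 \<one> \<zero> \<zero> \<zero> \<one> \<zero> \<zero> \<zero> \<one>"
  by (rule eq_M3I[where C = UNIV]) (auto simp: mat_monoid_def)

lemma triple_product_3:
  assumes "{x1, x2, x3, y11, y12, y13, y21, y22, y23, y31, y32, y33, z1, z2, z3} \<subseteq> carrier R"
  shows "(x1 \<otimes> y11 \<oplus> x2 \<otimes> y21 \<oplus> x3 \<otimes> y31) \<otimes> z1 \<oplus>
      (x1 \<otimes> y12 \<oplus> x2 \<otimes> y22 \<oplus> x3 \<otimes> y32) \<otimes> z2 \<oplus>
      (x1 \<otimes> y13 \<oplus> x2 \<otimes> y23 \<oplus> x3 \<otimes> y33) \<otimes> z3 =
    x1 \<otimes> (y11 \<otimes> z1 \<oplus> y12 \<otimes> z2 \<oplus> y13 \<otimes> z3) \<oplus>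
      x2 \<otimes> (y21 \<otimes> z1 \<oplus> y22 \<otimes> z2 \<oplus> y23 \<otimes> z3) \<oplus>
      x3 \<otimes> (y31 \<otimes> z1 \<oplus> y32 \<otimes> z2 \<oplus> y33 \<otimes> z3)"
  using assms by (simp add: r_distr l_distr m_assoc a_ac)

lemma mat3_monoid: "monoid (mat_monoid 3 R)"
proof (rule monoidI)
  fix x y assume "x \<in> carrier (mat_monoid 3 R)" "y \<in> carrier (mat_monoid 3 R)"
  then show "x \<otimes>\<^bsub>mat_monoid 3 R\<^esub> y \<in> carrier (mat_monoid 3 R)"
    by (elim mat3_cases) (simp add: mat3_mult)
next
  fix x y z
  assume x: "x \<in> carrier (mat_monoid 3 R)" and y: "y \<in> carrier (mat_monoid 3 R)"
    and z: "z \<in> carrier (mat_monoid 3 R)"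
  obtain a b c d e f g h i where x: "{a, b, c, d, e, f, g, h, i} \<subseteq> carrier R" "x = M3 a b c d e f g h i"
    using mat3_cases[OF x] .
  obtain a' b' c' d' e' f' g' h' i' where
    y: "{a', b', c', d', e', f', g', h', i'} \<subseteq> carrier R" "y = M3 a' b' c' d' e' f' g' h' i'"
    using mat3_cases[OF y] .
  obtain a'' b'' c'' d'' e'' f'' g'' h'' i'' where
    z: "{a'', b'', c'', d'', e'', f'', g'', h'', i''} \<subseteq> carrier R"
       "z = M3 a'' b'' c'' d'' e'' f'' g'' h'' i''"
    using mat3_cases[OF z] .
  show "x \<otimes>\<^bsub>mat_monoid 3 R\<^esub> y \<otimes>\<^bsub>mat_monoid 3 R\<^esub> z = x \<otimes>\<^bsub>mat_monoid 3 R\<^esub> (y \<otimes>\<^bsub>mat_monoid 3 R\<^esub> z)"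
    unfolding x(2) y(2) z(2) using x(1) y(1) z(1)
    by (simp only: mat3_mult insert_subset empty_subsetI simp_thms a_closed m_closed triple_product_3)
next
  fix x assume x: "x \<in> carrier (mat_monoid 3 R)"
  obtain a b c d e f g h i where x: "{a, b, c, d, e, f, g, h, i} \<subseteq> carrier R" "x = M3 a b c d e f g h i"
    using mat3_cases[OF x] .
  show "\<one>\<^bsub>mat_monoid 3 R\<^esub> \<otimes>\<^bsub>mat_monoid 3 R\<^esub> x = x" "x \<otimes>\<^bsub>mat_monoid 3 R\<^esub> \<one>\<^bsub>mat_monoid 3 R\<^esub> = x"
    unfolding x(2) mat3_one using x(1) by (simp_all add: mat3_mult)
qed (simp add: mat3_one)

lemma group_GL3: "group (GL 3 R)"
  unfolding GL_def by (rule monoid.units_group[OF mat3_monoid])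

lemma mult_GL: "x \<otimes>\<^bsub>GL n R\<^esub> y = x \<otimes>\<^bsub>mat_monoid n R\<^esub> y"
  and one_GL: "\<one>\<^bsub>GL n R\<^esub> = \<one>\<^bsub>mat_monoid n R\<^esub>"
  and carrier_GL: "carrier (GL n R) = Units (mat_monoid n R)"
  by (auto simp: GL_def units_of_def)

lemma GL3_cases:
  assumes "M \<in> carrier (GL 3 R)"
  obtains a b c d e f g h i where "{a, b, c, d, e, f, g, h, i} \<subseteq> carrier R" "M = M3 a b c d e f g h i"
proof -
  have "M \<in> carrier (mat_monoid 3 R)"
    using assms monoid.Units_closed[OF mat3_monoid] by (simp add: carrier_GL)
  from mat3_cases[OF this that] show thesis .
qed

lemma GL3_inverse_cases:
  assumes "M \<in> carrier (GL 3 R)"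
  obtains a b c d e f g h i where "{a, b, c, d, e, f, g, h, i} \<subseteq> carrier R"
    "inv\<^bsub>GL 3 R\<^esub> M = M3 a b c d e f g h i"
    "M \<otimes>\<^bsub>mat_monoid 3 R\<^esub> M3 a b c d e f g h i = M3 \<one> \<zero> \<zero> \<zero> \<one> \<zero> \<zero> \<zero> \<one>"
    "M3 a b c d e f g h i \<otimes>\<^bsub>mat_monoid 3 R\<^esub> M = M3 \<one> \<zero> \<zero> \<zero> \<one> \<zero> \<zero> \<zero> \<one>"
proof -
  interpret G: group "GL 3 R" by (rule group_GL3)
  obtain a b c d e f g h i where N: "{a, b, c, d, e, f, g, h, i} \<subseteq> carrier R"
    "inv\<^bsub>GL 3 R\<^esub> M = M3 a b c d e f g h i"
    using GL3_cases[OF G.inv_closed[OF assms]] .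
  note 1 = G.r_inv[OF assms, unfolded N(2) mult_GL one_GL mat3_one]
    and 2 = G.l_inv[OF assms, unfolded N(2) mult_GL one_GL mat3_one]
  show thesis by (rule that[OF N 1 2])
qed

lemma in_GL3I:
  assumes "M \<in> carrier (mat_monoid 3 R)" "N \<in> carrier (mat_monoid 3 R)"
    "M \<otimes>\<^bsub>mat_monoid 3 R\<^esub> N = \<one>\<^bsub>mat_monoid 3 R\<^esub>" "N \<otimes>\<^bsub>mat_monoid 3 R\<^esub> M = \<one>\<^bsub>mat_monoid 3 R\<^esub>"
  shows "M \<in> carrier (GL 3 R)"
  using assms by (auto simp: carrier_GL Units_def)

lemma zero_if_mult_zero:
  assumes "x \<in> carrier R" "y \<in> carrier R" "z \<in> carrier R" "x \<otimes> y = \<one>" "x \<otimes> z = \<zero>"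
  shows "z = \<zero>"
proof -
  have "z = z \<otimes> (x \<otimes> y)" using assms by simp
  also have "\<dots> = (x \<otimes> z) \<otimes> y" using assms(1-3) by algebra
  finally show ?thesis using assms by simp
qed

lemma upper_triangular_M3_iff:
  "M3 a b c d e f g h i \<in> upper_triangular_GL 3 R \<longleftrightarrow>
    M3 a b c d e f g h i \<in> carrier (GL 3 R) \<and> d = \<zero> \<and> g = \<zero> \<and> h = \<zero>"
proof -
  have *: "(\<forall>r<3. \<forall>s<r. P r s) \<longleftrightarrow> P (Suc 0) 0 \<and> P 2 0 \<and> P 2 (Suc 0)" for P :: "nat \<Rightarrow> nat \<Rightarrow> bool"
    by (auto simp: less_3_iff less_2_cases_iff)
  show ?thesis unfolding upper_triangular_GL_def * by auto
qed

lemma upper_triangular_cases: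
  assumes "M \<in> upper_triangular_GL 3 R"
  obtains a b c e f i where "{a, b, c, e, f, i} \<subseteq> carrier R" "a \<in> Units R" "M = M3 a b c \<zero> e f \<zero> \<zero> i"
proof -
  have M: "M \<in> carrier (GL 3 R)" using assms by (auto simp: upper_triangular_GL_def)
  obtain a b c d e f g h i where c: "{a, b, c, d, e, f, g, h, i} \<subseteq> carrier R" "M = M3 a b c d e f g h i"
    using GL3_cases[OF M] .
  then have z: "d = \<zero>" "g = \<zero>" "h = \<zero>" using assms by (auto simp: upper_triangular_M3_iff)
  obtain a' b' c' d' e' f' g' h' i' where N: "{a', b', c', d', e', f', g', h', i'} \<subseteq> carrier R"
    "M3 a' b' c' d' e' f' g' h' i' \<otimes>\<^bsub>mat_monoid 3 R\<^esub> M = M3 \<one> \<zero> \<zero> \<zero> \<one> \<zero> \<zero> \<zero> \<one>"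
    using GL3_inverse_cases[OF M] .
  have "a' \<otimes> a = \<one>" using N c z by (simp add: mat3_mult M3_eq_iff)
  then have "a \<in> Units R" using N c by (auto simp: Units_def m_comm)
  then show thesis using that[of a b c e f i] c z by simp
qed

lemma subgroup_upper_triangular: "subgroup (upper_triangular_GL 3 R) (GL 3 R)"
proof -
  interpret G: group "GL 3 R" by (rule group_GL3)
  show ?thesis
  proof (rule G.subgroupI)
    show "upper_triangular_GL 3 R \<subseteq> carrier (GL 3 R)" by (auto simp: upper_triangular_GL_def)
    have "M3 \<one> \<zero> \<zero> \<zero> \<one> \<zero> \<zero> \<zero> \<one> \<in> upper_triangular_GL 3 R"
      using G.one_closed by (simp add: upper_triangular_M3_iff one_GL mat3_one)
    then show "upper_triangular_GL 3 R \<noteq> {}" by (metis emptyE)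
  next
    fix M assume M: "M \<in> upper_triangular_GL 3 R"
    then have MG: "M \<in> carrier (GL 3 R)" by (auto simp: upper_triangular_GL_def)
    obtain a b c e f i where c: "{a, b, c, e, f, i} \<subseteq> carrier R" "a \<in> Units R" "M = M3 a b c \<zero> e f \<zero> \<zero> i"
      using upper_triangular_cases[OF M] .
    obtain a' b' c' d' e' f' g' h' i' where N: "{a', b', c', d', e', f', g', h', i'} \<subseteq> carrier R"
      "inv\<^bsub>GL 3 R\<^esub> M = M3 a' b' c' d' e' f' g' h' i'"
      "M \<otimes>\<^bsub>mat_monoid 3 R\<^esub> M3 a' b' c' d' e' f' g' h' i' = M3 \<one> \<zero> \<zero> \<zero> \<one> \<zero> \<zero> \<zero> \<one>"
      using GL3_inverse_cases[OF MG] .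
    have eqs: "i \<otimes> g' = \<zero>" "i \<otimes> h' = \<zero>" "i \<otimes> i' = \<one>" "e \<otimes> d' \<oplus> f \<otimes> g' = \<zero>" "e \<otimes> e' \<oplus> f \<otimes> h' = \<one>"
      using N c by (simp_all add: mat3_mult M3_eq_iff)
    have c': "e \<in> carrier R" "f \<in> carrier R" "i \<in> carrier R" "d' \<in> carrier R" "e' \<in> carrier R"
      "g' \<in> carrier R" "h' \<in> carrier R" "i' \<in> carrier R"
      using c(1) N(1) by auto
    have z: "g' = \<zero>" "h' = \<zero>"
      using zero_if_mult_zero[OF c'(3,8) _ eqs(3)] eqs(1,2) c' by auto
    have "e \<otimes> d' = \<zero>" "e \<otimes> e' = \<one>"
      using eqs(4,5) c' unfolding z by auto
    then have "d' = \<zero>" using zero_if_mult_zero[of e e' d'] c' by simp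
    then show "inv\<^bsub>GL 3 R\<^esub> M \<in> upper_triangular_GL 3 R"
      using G.inv_closed[OF MG] unfolding N(2) z upper_triangular_M3_iff by simp
  next
    fix M N assume M: "M \<in> upper_triangular_GL 3 R" and N: "N \<in> upper_triangular_GL 3 R"
    obtain a b c e f i where M': "{a, b, c, e, f, i} \<subseteq> carrier R" "a \<in> Units R" "M = M3 a b c \<zero> e f \<zero> \<zero> i"
      using upper_triangular_cases[OF M] .
    obtain a' b' c' e' f' i' where N': "{a', b', c', e', f', i'} \<subseteq> carrier R" "a' \<in> Units R" "N = M3 a' b' c' \<zero> e' f' \<zero> \<zero> i'"
      using upper_triangular_cases[OF N] .
    have "M \<otimes>\<^bsub>GL 3 R\<^esub> N \<in> carrier (GL 3 R)"
      using M N by (intro G.m_closed) (simp_all add: upper_triangular_GL_def)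
    then show "M \<otimes>\<^bsub>GL 3 R\<^esub> N \<in> upper_triangular_GL 3 R"
      using M'(1) N'(1) unfolding M'(3) N'(3) by (simp add: mult_GL mat3_mult upper_triangular_M3_iff)
  qed
qed

lemma unipotent_in_upper_triangular:
  assumes "x \<in> carrier R" "y \<in> carrier R" "z \<in> carrier R"
  shows "M3 \<one> x y \<zero> \<one> z \<zero> \<zero> \<one> \<in> upper_triangular_GL 3 R"
proof -
  let ?M = "M3 \<one> x y \<zero> \<one> z \<zero> \<zero> \<one>"
  let ?N = "M3 \<one> (\<ominus> x) (x \<otimes> z \<ominus> y) \<zero> \<one> (\<ominus> z) \<zero> \<zero> \<one>"
  have c: "\<ominus> x \<in> carrier R" "\<ominus> z \<in> carrier R" "x \<otimes> z \<ominus> y \<in> carrier R" using assms by auto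
  have "x \<otimes> z \<ominus> y \<oplus> x \<otimes> (\<ominus> z) \<oplus> y = \<zero>" "y \<oplus> (\<ominus> x) \<otimes> z \<oplus> (x \<otimes> z \<ominus> y) = \<zero>"
    "\<ominus> x \<oplus> x = \<zero>" "x \<oplus> \<ominus> x = \<zero>" "\<ominus> z \<oplus> z = \<zero>" "z \<oplus> \<ominus> z = \<zero>"
    using assms by algebra+
  note eqs = this
  have "?M \<otimes>\<^bsub>mat_monoid 3 R\<^esub> ?N = \<one>\<^bsub>mat_monoid 3 R\<^esub>"
    unfolding mat3_one
    by (subst mat3_mult)
      (simp_all only: c assms insert_subset empty_subsetI zero_closed one_closed simp_thms M3_eq_iff
        l_one r_one l_null r_null l_zero r_zero eqs m_closed)
  moreover have "?N \<otimes>\<^bsub>mat_monoid 3 R\<^esub> ?M = \<one>\<^bsub>mat_monoid 3 R\<^esub>"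
    unfolding mat3_one
    by (subst mat3_mult)
      (simp_all only: c assms insert_subset empty_subsetI zero_closed one_closed simp_thms M3_eq_iff
        l_one r_one l_null r_null l_zero r_zero eqs m_closed)
  ultimately have "?M \<in> carrier (GL 3 R)"
    using assms c by (intro in_GL3I[where N = ?N]) simp_all
  then show ?thesis by (simp add: upper_triangular_M3_iff)
qed

lemma diagonal_in_upper_triangular:
  assumes "s \<in> Units R" "t \<in> Units R" "u \<in> Units R"
  shows "M3 s \<zero> \<zero> \<zero> t \<zero> \<zero> \<zero> u \<in> upper_triangular_GL 3 R"
proof -
  have "s \<in> carrier R" "t \<in> carrier R" "u \<in> carrier R" using assms by auto
  with assms have "M3 s \<zero> \<zero> \<zero> t \<zero> \<zero> \<zero> u \<in> carrier (GL 3 R)"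
    by (intro in_GL3I[where N = "M3 (inv s) \<zero> \<zero> \<zero> (inv t) \<zero> \<zero> \<zero> (inv u)"])
      (simp_all add: mat3_mult mat3_one)
  then show ?thesis by (simp add: upper_triangular_M3_iff)
qed

definition bruhat :: "(nat \<times> nat \<Rightarrow> 'a) \<Rightarrow> (nat \<times> nat \<Rightarrow> 'a) \<Rightarrow> bool"
  where "bruhat M N \<longleftrightarrow> (\<exists>P\<in>upper_triangular_GL 3 R. \<exists>Q\<in>upper_triangular_GL 3 R.
    N = P \<otimes>\<^bsub>GL 3 R\<^esub> M \<otimes>\<^bsub>GL 3 R\<^esub> Q)"

end

lemma (in group) double_coset_eq_iff:
  assumes H: "subgroup H G" and x: "x \<in> carrier G" and y: "y \<in> carrier G"
  shows "(H #> x) <#> H = (H #> y) <#> H \<longleftrightarrow> (\<exists>a\<in>H. \<exists>b\<in>H. y = a \<otimes> x \<otimes> b)"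
proof -
  have dc: "(H #> z) <#> H = {a \<otimes> z \<otimes> b | a b. a \<in> H \<and> b \<in> H}" for z
    unfolding r_coset_def set_mult_def by auto
  have H': "\<And>a. a \<in> H \<Longrightarrow> a \<in> carrier G" using subgroup.mem_carrier[OF H] .
  show ?thesis
  proof
    assume e: "(H #> x) <#> H = (H #> y) <#> H"
    have "y = \<one> \<otimes> y \<otimes> \<one>" using y by simp
    then have "y \<in> (H #> y) <#> H" unfolding dc mem_Collect_eq using subgroup.one_closed[OF H] by (intro exI conjI)
    then have "y \<in> (H #> x) <#> H" using e by simp
    then show "\<exists>a\<in>H. \<exists>b\<in>H. y = a \<otimes> x \<otimes> b" unfolding dc by blast
  next
    assume "\<exists>a\<in>H. \<exists>b\<in>H. y = a \<otimes> x \<otimes> b"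
    then obtain a b where ab: "a \<in> H" "b \<in> H" "y = a \<otimes> x \<otimes> b" by blast
    have c: "a \<in> carrier G" "b \<in> carrier G" using ab H' by auto
    have "inv a \<otimes> y \<otimes> inv b = (inv a \<otimes> a) \<otimes> x \<otimes> (b \<otimes> inv b)"
      using c x by (simp only: ab(3) m_assoc m_closed inv_closed)
    then have xy: "x = inv a \<otimes> y \<otimes> inv b" using c x by simp
    have sub: "(H #> w) <#> H \<subseteq> (H #> v) <#> H"
      if "c \<in> H" "d \<in> H" "v \<in> carrier G" "w = c \<otimes> v \<otimes> d" for c d v w
    proof
      fix z assume "z \<in> (H #> w) <#> H"
      then obtain a' b' where z: "a' \<in> H" "b' \<in> H" "z = a' \<otimes> w \<otimes> b'" unfolding dc by blast
      have c': "a' \<in> carrier G" "b' \<in> carrier G" "c \<in> carrier G" "d \<in> carrier G"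
        using z(1,2) that(1,2) H' by auto
      have "z = (a' \<otimes> c) \<otimes> v \<otimes> (d \<otimes> b')"
        unfolding z(3) that(4) using c' that(3) by (simp only: m_assoc m_closed)
      moreover have "a' \<otimes> c \<in> H" "d \<otimes> b' \<in> H"
        using z that subgroup.m_closed[OF H] by auto
      ultimately show "z \<in> (H #> v) <#> H" unfolding dc mem_Collect_eq by (intro exI conjI)
    qed
    show "(H #> x) <#> H = (H #> y) <#> H"
    proof (rule subset_antisym)
      show "(H #> y) <#> H \<subseteq> (H #> x) <#> H" by (rule sub[OF ab(1,2) x ab(3)])
      show "(H #> x) <#> H \<subseteq> (H #> y) <#> H"
        by (rule sub[OF subgroup.m_inv_closed[OF H ab(1)] subgroup.m_inv_closed[OF H ab(2)] y xy])
    qed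
  qed
qed

context cring
begin

lemma bruhat_closed:
  assumes "M \<in> carrier (GL 3 R)" "bruhat M N"
  shows "N \<in> carrier (GL 3 R)"
proof -
  interpret G: group "GL 3 R" by (rule group_GL3)
  obtain P Q where "P \<in> upper_triangular_GL 3 R" "Q \<in> upper_triangular_GL 3 R"
    and N: "N = P \<otimes>\<^bsub>GL 3 R\<^esub> M \<otimes>\<^bsub>GL 3 R\<^esub> Q"
    using assms(2) unfolding bruhat_def by (elim bexE)
  then have "P \<in> carrier (GL 3 R)" "Q \<in> carrier (GL 3 R)"
    by (simp_all add: upper_triangular_GL_def)
  then show ?thesis unfolding N using assms(1) by (intro G.m_closed)
qed

lemma bruhat_iff:
  assumes "M \<in> carrier (GL 3 R)" "N \<in> carrier (GL 3 R)"
  shows "bruhat M N \<longleftrightarrow>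
    (upper_triangular_GL 3 R #>\<^bsub>GL 3 R\<^esub> M) <#>\<^bsub>GL 3 R\<^esub> upper_triangular_GL 3 R =
    (upper_triangular_GL 3 R #>\<^bsub>GL 3 R\<^esub> N) <#>\<^bsub>GL 3 R\<^esub> upper_triangular_GL 3 R"
  by (simp only: bruhat_def group.double_coset_eq_iff[OF group_GL3 subgroup_upper_triangular assms])

lemma bruhat_trans:
  assumes "M \<in> carrier (GL 3 R)" "bruhat M N" "bruhat N P"
  shows "bruhat M P"
proof -
  have c: "N \<in> carrier (GL 3 R)" "P \<in> carrier (GL 3 R)"
    using bruhat_closed assms by auto
  show ?thesis
    using assms(2,3) unfolding bruhat_iff[OF assms(1) c(1)] bruhat_iff[OF c] bruhat_iff[OF assms(1) c(2)]
    by (rule trans)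
qed

lemma card_double_cosets_le:
  assumes "finite F" "\<And>M. M \<in> carrier (GL 3 R) \<Longrightarrow> \<exists>N\<in>F. bruhat M N"
  shows "finite (double_cosets (GL 3 R) (upper_triangular_GL 3 R) (upper_triangular_GL 3 R))"
    and "card (double_cosets (GL 3 R) (upper_triangular_GL 3 R) (upper_triangular_GL 3 R)) \<le> card F"
proof -
  let ?dc = "\<lambda>M. (upper_triangular_GL 3 R #>\<^bsub>GL 3 R\<^esub> M) <#>\<^bsub>GL 3 R\<^esub> upper_triangular_GL 3 R"
  have *: "double_cosets (GL 3 R) (upper_triangular_GL 3 R) (upper_triangular_GL 3 R) \<subseteq> ?dc ` F"
  proof
    fix D assume "D \<in> double_cosets (GL 3 R) (upper_triangular_GL 3 R) (upper_triangular_GL 3 R)"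
    then obtain M where M: "M \<in> carrier (GL 3 R)" "D = ?dc M" unfolding double_cosets_def by auto
    obtain N where N: "N \<in> F" "bruhat M N" using assms(2)[OF M(1)] by (elim bexE)
    have "D = ?dc N" unfolding M(2) using bruhat_iff[OF M(1) bruhat_closed[OF M(1) N(2)]] N(2) by (rule iffD1)
    then show "D \<in> ?dc ` F" using N(1) by (rule image_eqI)
  qed
  show "finite (double_cosets (GL 3 R) (upper_triangular_GL 3 R) (upper_triangular_GL 3 R))"
    by (rule finite_subset[OF *]) (simp add: assms(1))
  have "card (double_cosets (GL 3 R) (upper_triangular_GL 3 R) (upper_triangular_GL 3 R)) \<le> card (?dc ` F)"
    by (rule card_mono[OF _ *]) (simp add: assms(1))
  also have "\<dots> \<le> card F" by (rule card_image_le[OF assms(1)])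
  finally show "card (double_cosets (GL 3 R) (upper_triangular_GL 3 R) (upper_triangular_GL 3 R)) \<le> card F" .
qed

lemma card_double_cosets_ge:
  assumes "finite (double_cosets (GL 3 R) (upper_triangular_GL 3 R) (upper_triangular_GL 3 R))"
    and "\<And>x. x \<in> I \<Longrightarrow> f x \<in> carrier (GL 3 R)"
    and "\<And>x y. x \<in> I \<Longrightarrow> y \<in> I \<Longrightarrow> bruhat (f x) (f y) \<Longrightarrow> x = y"
  shows "card I \<le> card (double_cosets (GL 3 R) (upper_triangular_GL 3 R) (upper_triangular_GL 3 R))"
proof (rule card_inj_on_le[OF _ _ assms(1)])
  let ?dc = "\<lambda>M. (upper_triangular_GL 3 R #>\<^bsub>GL 3 R\<^esub> M) <#>\<^bsub>GL 3 R\<^esub> upper_triangular_GL 3 R"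
  show "inj_on (\<lambda>x. ?dc (f x)) I"
  proof (rule inj_onI)
    fix x y assume *: "x \<in> I" "y \<in> I" "?dc (f x) = ?dc (f y)"
    then have "bruhat (f x) (f y)" using bruhat_iff[OF assms(2)[OF *(1)] assms(2)[OF *(2)]] by simp
    then show "x = y" by (rule assms(3)[OF *(1,2)])
  qed
  show "(\<lambda>x. ?dc (f x)) ` I \<subseteq> double_cosets (GL 3 R) (upper_triangular_GL 3 R) (upper_triangular_GL 3 R)"
    using assms(2) unfolding double_cosets_def by auto
qed

end

section \<open>Counting classes of triples\<close>

context finite_chain_ring
begin

lemma p_pow_pos:
  assumes "0 < n" obtains y where "y \<in> carrier R" "p [^] (n::nat) = p \<otimes> y"
proof -
  obtain m where "n = Suc m" using assms by (cases n) auto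
  then have "p [^] n = p \<otimes> p [^] m" by (simp add: m_comm)
  then show thesis by (rule that[rotated]) simp
qed

definition split_pair :: "nat \<Rightarrow> nat \<Rightarrow> nat \<Rightarrow> 'a \<Rightarrow> bool"
  where "split_pair \<beta> i j e \<longleftrightarrow> e \<in> carrier R \<and>
    (\<exists>u\<in>Units R. e = u \<otimes> p [^] i) \<and> (\<exists>u\<in>Units R. p [^] \<beta> \<ominus> e = u \<otimes> p [^] j)"

lemma pow_diff_multiple:
  assumes "u \<in> carrier R" "v \<in> carrier R" "n \<le> i"
  shows "\<exists>z\<in>carrier R. u \<otimes> p [^] (i::nat) \<ominus> v \<otimes> p [^] i = p [^] n \<otimes> z"
proof -
  define a b where "a = p [^] n" and "b = p [^] (i - n)"
  have c: "a \<in> carrier R" "b \<in> carrier R" by (simp_all add: a_def b_def)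
  have e: "p [^] i = a \<otimes> b" unfolding a_def b_def by (rule pow_split[OF assms(3)])
  have "u \<otimes> (a \<otimes> b) \<ominus> v \<otimes> (a \<otimes> b) = a \<otimes> ((u \<ominus> v) \<otimes> b)" using c assms by algebra
  then show ?thesis unfolding e a_def[symmetric] using c assms by (intro bexI[of _ "(u \<ominus> v) \<otimes> b"]) auto
qed

lemma split_pair_diff:
  assumes "split_pair \<beta> i j e" "split_pair \<beta> i j f"
  shows "\<exists>z\<in>carrier R. e = f \<oplus> p [^] max i j \<otimes> z"
proof -
  obtain u v where u: "u \<in> Units R" "e = u \<otimes> p [^] i" "v \<in> Units R" "p [^] \<beta> \<ominus> e = v \<otimes> p [^] j"
    using assms(1) unfolding split_pair_def by auto
  obtain u' v' where u': "u' \<in> Units R" "f = u' \<otimes> p [^] i" "v' \<in> Units R" "p [^] \<beta> \<ominus> f = v' \<otimes> p [^] j"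
    using assms(2) unfolding split_pair_def by auto
  have c: "e \<in> carrier R" "f \<in> carrier R" "p [^] \<beta> \<in> carrier R" using assms by (auto simp: split_pair_def)
  have "e \<ominus> f = u \<otimes> p [^] i \<ominus> u' \<otimes> p [^] i" using u(2) u'(2) by simp
  moreover have "e \<ominus> f = v' \<otimes> p [^] j \<ominus> v \<otimes> p [^] j"
    unfolding u(4)[symmetric] u'(4)[symmetric] using c by algebra
  ultimately obtain z where z: "z \<in> carrier R" "e \<ominus> f = p [^] max i j \<otimes> z"
    using pow_diff_multiple[of u u' i i] pow_diff_multiple[of v' v j j] u(1,3) u'(1,3)
    by (cases "i \<le> j") (auto simp: max_def)
  have "e = f \<oplus> (e \<ominus> f)" using c by algebra
  then show ?thesis using z by auto
qed

lemma split_pair_min: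
  assumes "split_pair \<beta> i j e" "i \<le> k" "j \<le> k" "\<beta> \<le> k"
  shows "min i j \<le> \<beta>"
proof (rule ccontr)
  assume a: "\<not> min i j \<le> \<beta>"
  define n where "n = min i j"
  have n: "\<beta> < n" "n \<le> k" "n \<le> i" "n \<le> j" using a assms by (auto simp: n_def)
  obtain u v where u: "u \<in> Units R" "e = u \<otimes> p [^] i" "v \<in> Units R" "p [^] \<beta> \<ominus> e = v \<otimes> p [^] j"
    using assms(1) unfolding split_pair_def by auto
  define g h l where "g = p [^] n" and "h = p [^] (i - n)" and "l = p [^] (j - n)"
  have c: "g \<in> carrier R" "h \<in> carrier R" "l \<in> carrier R" "u \<in> carrier R" "v \<in> carrier R" "e \<in> carrier R" "p [^] \<beta> \<in> carrier R"
    using u(1,3) assms(1) by (auto simp: g_def h_def l_def split_pair_def)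
  have i: "p [^] i = g \<otimes> h" and j: "p [^] j = g \<otimes> l"
    unfolding g_def h_def l_def using pow_split n by auto
  have "p [^] \<beta> = (p [^] \<beta> \<ominus> e) \<oplus> e" using c by algebra
  also have "\<dots> = v \<otimes> (g \<otimes> l) \<oplus> u \<otimes> (g \<otimes> h)" unfolding u(4) unfolding i j u(2) ..
  also have "\<dots> = g \<otimes> (v \<otimes> l \<oplus> u \<otimes> h)" using c by algebra
  finally have "p [^] \<beta> \<otimes> \<one> = p [^] n \<otimes> (v \<otimes> l \<oplus> u \<otimes> h)" using c unfolding g_def by simp
  then obtain z where z: "z \<in> carrier R" "\<one> = p [^] (n - \<beta>) \<otimes> z"
    using pow_cancel[of \<one> "v \<otimes> l \<oplus> u \<otimes> h" \<beta> n] n c by auto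
  obtain y where y: "y \<in> carrier R" "p [^] (n - \<beta>) = p \<otimes> y" using p_pow_pos[of "n - \<beta>"] n by auto
  have "\<one> = p \<otimes> (y \<otimes> z)" using z y by (simp add: m_assoc)
  then show False using one_not_multiple[of "y \<otimes> z"] z y by simp
qed

definition triple_reps :: "('a \<times> 'a \<times> 'a) set"
  where "triple_reps = (\<lambda>(\<beta>, \<gamma>). (\<zero>, p [^] \<beta>, p [^] \<gamma>)) ` ({..k} \<times> {..k}) \<union>
    (\<lambda>(\<alpha>, \<beta>, i, j, t). (p [^] \<alpha>, p [^] \<beta>, p [^] \<alpha> \<otimes> ((SOME e. split_pair \<beta> i j e) \<oplus> p [^] max i j \<otimes> t))) `
      ({..k} \<times> {..k} \<times> {..k} \<times> {..k} \<times> T_mod (k div 3))"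

lemma finite_triple_reps: "finite triple_reps"
  unfolding triple_reps_def using T_mod_finite by simp

lemma card_triple_reps: "card triple_reps \<le> (k + 1)\<^sup>2 + (k + 1) ^ 4 * card T ^ (k div 3)"
proof -
  have 1: "card ((\<lambda>(\<beta>, \<gamma>). (\<zero>, p [^] \<beta>, p [^] \<gamma>)) ` ({..k} \<times> {..k})) \<le> (k + 1)\<^sup>2"
    by (rule order.trans[OF card_image_le]) (simp_all add: power2_eq_square)
  have "card ((\<lambda>(\<alpha>, \<beta>, i, j, t). (p [^] \<alpha>, p [^] \<beta>, p [^] \<alpha> \<otimes> ((SOME e. split_pair \<beta> i j e) \<oplus> p [^] max i j \<otimes> t))) `
      ({..k} \<times> {..k} \<times> {..k} \<times> {..k} \<times> T_mod (k div 3))) \<le> card ({..k} \<times> {..k} \<times> {..k} \<times> {..k} \<times> T_mod (k div 3))"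
    using T_mod_finite by (intro card_image_le) simp
  also have "\<dots> \<le> (k + 1) ^ 4 * card T ^ (k div 3)"
    using card_T_mod_le[of "k div 3"]
    by (simp add: card_cartesian_product power4_eq_xxxx mult.assoc del: mult_Suc mult_Suc_right)
  finally show ?thesis
    unfolding triple_reps_def using 1 by (intro order.trans[OF card_Un_le] add_mono)
qed

end

locale triple_relation = finite_chain_ring +
  fixes E :: "'a \<times> 'a \<times> 'a \<Rightarrow> 'a \<times> 'a \<times> 'a \<Rightarrow> bool"
  assumes E_trans: "\<lbrakk>E u v; E v w\<rbrakk> \<Longrightarrow> E u w"
    and E_scale: "\<lbrakk>a \<in> carrier R; b \<in> carrier R; c \<in> carrier R; s \<in> Units R; t \<in> Units R\<rbrakk>
      \<Longrightarrow> E (a, b, c) (s \<otimes> a, t \<otimes> b, s \<otimes> t \<otimes> c)"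
    and E_shear: "\<lbrakk>a \<in> carrier R; b \<in> carrier R; c \<in> carrier R; x \<in> carrier R; y \<in> carrier R; b = p \<otimes> y\<rbrakk>
      \<Longrightarrow> E (a, b, c) (a \<oplus> x \<otimes> c, b, c \<otimes> (\<one> \<oplus> x \<otimes> b))"
begin

lemma E_kill:
  assumes U: "u \<in> Units R" "w \<in> Units R" "z \<in> Units R" and le: "\<gamma> \<le> \<alpha>" "0 < \<beta>"
  shows "E (u \<otimes> p [^] (\<alpha>::nat), w \<otimes> p [^] (\<beta>::nat), z \<otimes> p [^] (\<gamma>::nat)) (\<zero>, p [^] \<beta>, p [^] \<gamma>)"
proof -
  define g m b where "g = p [^] \<gamma>" and "m = p [^] (\<alpha> - \<gamma>)" and "b = p [^] \<beta>"
  have c: "g \<in> carrier R" "m \<in> carrier R" "b \<in> carrier R" "u \<in> carrier R" "w \<in> carrier R" "z \<in> carrier R"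
     "inv z \<in> carrier R" "inv w \<in> carrier R"
    using U by (auto simp: g_def m_def b_def)
  obtain y where y: "y \<in> carrier R" "b = p \<otimes> y" unfolding b_def using p_pow_pos[OF le(2)] .
  define x v where "x = \<ominus> (u \<otimes> inv z \<otimes> m)" and "v = \<one> \<oplus> x \<otimes> (w \<otimes> b)"
  have x: "x \<in> carrier R" using c by (simp add: x_def)
  have "v = \<one> \<oplus> p \<otimes> (x \<otimes> w \<otimes> y)" unfolding v_def y(2) using x c y(1) p_closed by algebra
  then have v: "v \<in> Units R" using unit_plus_multiple[of \<one> "x \<otimes> w \<otimes> y"] x c y by simp
  then have vc: "v \<in> carrier R" by auto
  have "u \<otimes> (g \<otimes> m) \<oplus> x \<otimes> (z \<otimes> g) = u \<otimes> (g \<otimes> m) \<ominus> u \<otimes> (g \<otimes> m) \<otimes> (z \<otimes> inv z)"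
    unfolding x_def using c by algebra
  also have "\<dots> = \<zero>" using c U by (simp add: minus_eq r_neg)
  finally have 1: "u \<otimes> (g \<otimes> m) \<oplus> x \<otimes> (z \<otimes> g) = \<zero>" .
  have wb: "w \<otimes> b = p \<otimes> (w \<otimes> y)" unfolding y(2) using c y(1) p_closed by algebra
  have A: "E (u \<otimes> (g \<otimes> m), w \<otimes> b, z \<otimes> g) (\<zero>, w \<otimes> b, z \<otimes> g \<otimes> v)"
    using E_shear[of "u \<otimes> (g \<otimes> m)" "w \<otimes> b" "z \<otimes> g" x "w \<otimes> y"] c x y wb unfolding 1 v_def by simp
  define s where "s = w \<otimes> inv (z \<otimes> v)"
  have zv: "z \<otimes> v \<in> Units R" "w \<otimes> inv (z \<otimes> v) \<in> Units R" using U v by auto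
  have s: "s \<in> Units R" "inv (z \<otimes> v) \<in> carrier R" using zv by (auto simp: s_def)
  have "s \<otimes> inv w \<otimes> (z \<otimes> g \<otimes> v) = (w \<otimes> inv w) \<otimes> ((z \<otimes> v) \<otimes> inv (z \<otimes> v)) \<otimes> g"
    unfolding s_def using c vc s(2) by algebra
  also have "\<dots> = g" using U zv c by simp
  finally have 2: "s \<otimes> inv w \<otimes> (z \<otimes> g \<otimes> v) = g" .
  have "inv w \<otimes> (w \<otimes> b) = (w \<otimes> inv w) \<otimes> b" using c by algebra
  then have 3: "inv w \<otimes> (w \<otimes> b) = b" using U c by simp
  have B: "E (\<zero>, w \<otimes> b, z \<otimes> g \<otimes> v) (\<zero>, b, g)"
    using E_scale[of \<zero> "w \<otimes> b" "z \<otimes> g \<otimes> v" s "inv w"] c vc s U Units_closed[OF s(1)] unfolding 2 3 by simp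
  have "p [^] \<alpha> = g \<otimes> m" unfolding g_def m_def by (rule pow_split[OF le(1)])
  then show ?thesis using E_trans[OF A B] unfolding b_def[symmetric] g_def[symmetric] by simp
qed

text \<open>The parameter \<open>e\<close> of \<open>(p\<^sup>\<alpha>, p\<^sup>\<beta>, p\<^sup>\<alpha>e)\<close> only matters modulo the product of \<open>e\<close> and
  \<open>p\<^sup>\<beta> - e\<close>; this is what bounds the number of classes.\<close>

lemma E_move:
  assumes c: "e' \<in> carrier R" "y \<in> carrier R" and e: "e = p \<otimes> e'" and \<beta>: "0 < \<beta>"
  shows "E (p [^] (\<alpha>::nat), p [^] (\<beta>::nat), p [^] \<alpha> \<otimes> e)
    (p [^] \<alpha>, p [^] \<beta>, p [^] \<alpha> \<otimes> (e \<oplus> e \<otimes> (p [^] \<beta> \<ominus> e) \<otimes> y))"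
proof -
  define a b where "a = p [^] \<alpha>" and "b = p [^] \<beta>"
  obtain y' where y': "y' \<in> carrier R" "b = p \<otimes> y'" unfolding b_def using p_pow_pos[OF \<beta>] .
  have c': "a \<in> carrier R" "b \<in> carrier R" "e \<in> carrier R" using c e by (simp_all add: a_def b_def)
  define h where "h = \<one> \<ominus> y \<otimes> e"
  have "h = \<one> \<oplus> p \<otimes> (\<ominus> (y \<otimes> e'))" unfolding h_def e using c p_closed by algebra
  then have h: "h \<in> Units R" using unit_plus_multiple[of \<one> "\<ominus> (y \<otimes> e')"] c by simp
  then have hc: "h \<in> carrier R" "inv h \<in> carrier R" by auto
  define x where "x = y \<otimes> inv h"
  have x: "x \<in> carrier R" using c hc by (simp add: x_def)
  have "h \<otimes> x = y \<otimes> (h \<otimes> inv h)" unfolding x_def using c hc by algebra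
  then have hx: "h \<otimes> x = y" using h c by simp
  have A: "E (a, b, a \<otimes> e) (a \<oplus> x \<otimes> (a \<otimes> e), b, a \<otimes> e \<otimes> (\<one> \<oplus> x \<otimes> b))"
    using E_shear[of a b "a \<otimes> e" x y'] c' x y' by simp
  have "h \<otimes> (a \<oplus> x \<otimes> (a \<otimes> e)) = a \<otimes> (h \<oplus> (h \<otimes> x) \<otimes> e)" using c' hc x by algebra
  also have "\<dots> = a" unfolding hx unfolding h_def using c c' by algebra
  finally have 1: "h \<otimes> (a \<oplus> x \<otimes> (a \<otimes> e)) = a" .
  have "h \<otimes> \<one> \<otimes> (a \<otimes> e \<otimes> (\<one> \<oplus> x \<otimes> b)) = a \<otimes> (e \<otimes> (h \<oplus> (h \<otimes> x) \<otimes> b))" using c' hc x by algebra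
  also have "\<dots> = a \<otimes> (e \<oplus> e \<otimes> (b \<ominus> e) \<otimes> y)" unfolding hx unfolding h_def using c c' by algebra
  finally have 2: "h \<otimes> \<one> \<otimes> (a \<otimes> e \<otimes> (\<one> \<oplus> x \<otimes> b)) = a \<otimes> (e \<oplus> e \<otimes> (b \<ominus> e) \<otimes> y)" .
  have 3: "\<one> \<otimes> b = b" using c' by simp
  have B: "E (a \<oplus> x \<otimes> (a \<otimes> e), b, a \<otimes> e \<otimes> (\<one> \<oplus> x \<otimes> b)) (a, b, a \<otimes> (e \<oplus> e \<otimes> (b \<ominus> e) \<otimes> y))"
    using E_scale[of "a \<oplus> x \<otimes> (a \<otimes> e)" b "a \<otimes> e \<otimes> (\<one> \<oplus> x \<otimes> b)" h \<one>] c' x h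
    unfolding 1 2 3 by simp
  show ?thesis using E_trans[OF A B] unfolding a_def b_def .
qed

lemma E_normalize:
  assumes U: "u \<in> Units R" "w \<in> Units R" and c: "c \<in> carrier R"
  shows "\<exists>s\<in>Units R. E (u \<otimes> p [^] (\<alpha>::nat), w \<otimes> p [^] (\<beta>::nat), c) (p [^] \<alpha>, p [^] \<beta>, s \<otimes> c)"
proof -
  define a b where "a = p [^] \<alpha>" and "b = p [^] \<beta>"
  have c': "a \<in> carrier R" "b \<in> carrier R" "u \<in> carrier R" "w \<in> carrier R" "inv u \<in> carrier R" "inv w \<in> carrier R"
    using U by (auto simp: a_def b_def)
  have "inv u \<otimes> (u \<otimes> a) = (u \<otimes> inv u) \<otimes> a" "inv w \<otimes> (w \<otimes> b) = (w \<otimes> inv w) \<otimes> b" using c' by algebra+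
  then have 1: "inv u \<otimes> (u \<otimes> a) = a" "inv w \<otimes> (w \<otimes> b) = b" using U c' by simp_all
  have "E (u \<otimes> a, w \<otimes> b, c) (a, b, inv u \<otimes> inv w \<otimes> c)"
    using E_scale[of "u \<otimes> a" "w \<otimes> b" c "inv u" "inv w"] c' c U unfolding 1 by simp
  moreover have "inv u \<otimes> inv w \<in> Units R" using U by simp
  ultimately show ?thesis unfolding a_def b_def by (intro bexI)
qed

lemma E_cover:
  assumes U: "u \<in> Units R" "w \<in> Units R" and le: "0 < \<beta>" "\<beta> \<le> \<alpha>" "\<alpha> \<le> k" and c: "c \<in> carrier R"
  shows "\<exists>f\<in>triple_reps. E (u \<otimes> p [^] \<alpha>, w \<otimes> p [^] \<beta>, c) f"
proof -
  obtain z \<gamma> where z: "z \<in> Units R" "\<gamma> \<le> k" "c = z \<otimes> p [^] \<gamma>"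
    using unit_times_power[OF c] by auto
  show ?thesis
  proof (cases "\<gamma> \<le> \<alpha>")
    case True
    have "(\<zero>, p [^] \<beta>, p [^] \<gamma>) \<in> triple_reps"
      unfolding triple_reps_def using z le by (intro UnI1 image_eqI[of _ _ "(\<beta>, \<gamma>)"]) auto
    then show ?thesis using E_kill[OF U z(1) True le(1)] unfolding z(3) by (rule bexI[rotated])
  next
    case False
    obtain s where s: "s \<in> Units R" "E (u \<otimes> p [^] \<alpha>, w \<otimes> p [^] \<beta>, c) (p [^] \<alpha>, p [^] \<beta>, s \<otimes> c)"
      using E_normalize[OF U c, of \<alpha> \<beta>] by (elim bexE)
    obtain y0 where y0: "y0 \<in> carrier R" "p [^] (\<gamma> - \<alpha>) = p \<otimes> y0"
      using p_pow_pos[of "\<gamma> - \<alpha>"] False by auto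
    have zc: "z \<in> carrier R" "s \<in> carrier R" "p [^] \<alpha> \<in> carrier R" using z s by auto
    define e' where "e' = s \<otimes> z \<otimes> y0"
    define e where "e = p \<otimes> e'"
    have ec: "e \<in> carrier R" "e' \<in> carrier R" using zc y0 by (auto simp: e_def e'_def)
    have "p [^] \<gamma> = p [^] \<alpha> \<otimes> (p \<otimes> y0)" using pow_split[of \<alpha> \<gamma>] False y0 by simp
    then have "s \<otimes> c = s \<otimes> (z \<otimes> (p [^] \<alpha> \<otimes> (p \<otimes> y0)))" unfolding z(3) by simp
    also have "\<dots> = p [^] \<alpha> \<otimes> e" unfolding e_def e'_def using zc y0(1) p_closed by algebra
    finally have sc: "s \<otimes> c = p [^] \<alpha> \<otimes> e" .
    obtain u1 i where i: "u1 \<in> Units R" "i \<le> k" "e = u1 \<otimes> p [^] i" using unit_times_power[OF ec(1)] by auto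
    obtain u2 j where j: "u2 \<in> Units R" "j \<le> k" "p [^] \<beta> \<ominus> e = u2 \<otimes> p [^] j"
      using unit_times_power[of "p [^] \<beta> \<ominus> e"] ec by auto
    have e: "split_pair \<beta> i j e" unfolding split_pair_def using i j ec by auto
    define e0 where "e0 = (SOME e. split_pair \<beta> i j e)"
    have e0: "split_pair \<beta> i j e0" unfolding e0_def by (rule someI[of _ e]) (rule e)
    then have e0c: "e0 \<in> carrier R" by (simp add: split_pair_def)
    obtain r where r: "r \<in> carrier R" "e = e0 \<oplus> p [^] max i j \<otimes> r"
      using split_pair_diff[OF e e0] by (elim bexE)
    define t where "t = min (min i j) (k - \<alpha> - max i j)"
    have t: "t \<le> k div 3"
      using split_pair_min[OF e i(2) j(2)] le by (auto simp: t_def min_def max_def split: if_splits)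
    obtain \<tau> q' where \<tau>: "\<tau> \<in> T_mod (k div 3)" "q' \<in> carrier R" "r = \<tau> \<oplus> p [^] (k div 3) \<otimes> q'"
      using T_mod_cover[OF r(1), of "k div 3"] by (elim bexE)
    have \<tau>c: "\<tau> \<in> carrier R" using \<tau> T_mod_closed by auto
    define q where "q = p [^] (k div 3 - t) \<otimes> q'"
    have qc: "q \<in> carrier R" using \<tau> by (simp add: q_def)
    define f where "f = e0 \<oplus> p [^] max i j \<otimes> \<tau>"
    have fc: "f \<in> carrier R" using e0c \<tau>c by (simp add: f_def)
    have "p [^] (k div 3) \<otimes> q' = p [^] t \<otimes> q"
      unfolding q_def pow_split[OF t] using \<tau>(2) by (simp add: m_assoc)
    then have r': "r = \<tau> \<oplus> p [^] t \<otimes> q" unfolding \<tau>(3) by simp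
    have ef: "e = f \<oplus> p [^] (max i j + t) \<otimes> q"
    proof -
      define g l where "g = p [^] max i j" and "l = p [^] t"
      have "g \<in> carrier R" "l \<in> carrier R" by (simp_all add: g_def l_def)
      then have "e0 \<oplus> g \<otimes> (\<tau> \<oplus> l \<otimes> q) = e0 \<oplus> g \<otimes> \<tau> \<oplus> g \<otimes> l \<otimes> q"
        using e0c \<tau>c qc by algebra
      then show ?thesis unfolding r(2) f_def r' g_def l_def by (simp add: nat_pow_mult)
    qed
    have "\<exists>y\<in>carrier R. p [^] \<alpha> \<otimes> f = p [^] \<alpha> \<otimes> (e \<oplus> e \<otimes> (p [^] \<beta> \<ominus> e) \<otimes> y)"
    proof (cases "t = min i j")
      case True
      then have ij: "max i j + t = i + j" by auto
      define g l where "g = p [^] i" and "l = p [^] j"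
      have gl: "g \<in> carrier R" "l \<in> carrier R" by (simp_all add: g_def l_def)
      have uc: "u1 \<in> carrier R" "u2 \<in> carrier R" "inv u1 \<in> carrier R" "inv u2 \<in> carrier R" using i j by auto
      define y where "y = \<ominus> (inv u1 \<otimes> inv u2 \<otimes> q)"
      have y: "y \<in> carrier R" using uc qc by (simp add: y_def)
      have "(u1 \<otimes> g) \<otimes> (u2 \<otimes> l) \<otimes> y = \<ominus> ((u1 \<otimes> inv u1) \<otimes> (u2 \<otimes> inv u2) \<otimes> (g \<otimes> l) \<otimes> q)"
        unfolding y_def using uc gl qc by algebra
      also have "\<dots> = \<ominus> ((g \<otimes> l) \<otimes> q)" using i(1) j(1) gl by simp
      also have "g \<otimes> l = p [^] (max i j + t)" unfolding ij g_def l_def by (simp add: nat_pow_mult)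
      finally have ey: "e \<otimes> (p [^] \<beta> \<ominus> e) \<otimes> y = \<ominus> (p [^] (max i j + t) \<otimes> q)"
        unfolding j(3) unfolding i(3) g_def l_def .
      have "f = e \<oplus> \<ominus> (p [^] (max i j + t) \<otimes> q)"
      proof -
        define m where "m = p [^] (max i j + t)"
        have "m \<in> carrier R" by (simp add: m_def)
        then show ?thesis unfolding ef m_def[symmetric] using fc qc by algebra
      qed
      then show ?thesis using y by (intro bexI[of _ y]) (simp_all only: ey)
    next
      case False
      then have "k \<le> \<alpha> + (max i j + t)" by (auto simp: t_def min_def split: if_splits)
      then have z: "p [^] \<alpha> \<otimes> p [^] (max i j + t) = \<zero>" by (simp add: nat_pow_mult p_pow_large)
      define m where "m = p [^] (max i j + t)"
      have m: "m \<in> carrier R" by (simp add: m_def)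
      have "p [^] \<alpha> \<otimes> e = p [^] \<alpha> \<otimes> f \<oplus> (p [^] \<alpha> \<otimes> m) \<otimes> q"
        unfolding ef m_def[symmetric] using zc(3) fc qc m by algebra
      also have "\<dots> = p [^] \<alpha> \<otimes> f" using z zc fc qc unfolding m_def by simp
      finally have "p [^] \<alpha> \<otimes> e = p [^] \<alpha> \<otimes> f" .
      then show ?thesis using ec by (intro bexI[of _ \<zero>]) simp_all
    qed
    then obtain y where y: "y \<in> carrier R" "p [^] \<alpha> \<otimes> f = p [^] \<alpha> \<otimes> (e \<oplus> e \<otimes> (p [^] \<beta> \<ominus> e) \<otimes> y)"
      by (elim bexE)
    have "E (u \<otimes> p [^] \<alpha>, w \<otimes> p [^] \<beta>, c) (p [^] \<alpha>, p [^] \<beta>, p [^] \<alpha> \<otimes> f)"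
      unfolding y(2) using s(2) unfolding sc by (rule E_trans) (rule E_move[OF ec(2) y(1) e_def le(1)])
    moreover have "(p [^] \<alpha>, p [^] \<beta>, p [^] \<alpha> \<otimes> f) \<in> triple_reps"
      unfolding triple_reps_def f_def e0_def
      using i j le \<tau> by (intro UnI2 image_eqI[of _ _ "(\<alpha>, \<beta>, i, j, \<tau>)"]) auto
    ultimately show ?thesis by (intro bexI)
  qed
qed

end

section \<open>Reduction to lower unipotent matrices\<close>

context finite_chain_ring
begin

lemma bruhat_row:
  assumes "{a, b, c, d, e, f, g, h, i} \<subseteq> carrier R" "{x, y, z} \<subseteq> carrier R"
  shows "bruhat (M3 a b c d e f g h i)
    (M3 (a \<oplus> x \<otimes> d \<oplus> y \<otimes> g) (b \<oplus> x \<otimes> e \<oplus> y \<otimes> h) (c \<oplus> x \<otimes> f \<oplus> y \<otimes> i)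
        (d \<oplus> z \<otimes> g) (e \<oplus> z \<otimes> h) (f \<oplus> z \<otimes> i) g h i)"
proof -
  have 1: "M3 \<one> x y \<zero> \<one> z \<zero> \<zero> \<one> \<in> upper_triangular_GL 3 R"
    and 2: "M3 \<one> \<zero> \<zero> \<zero> \<one> \<zero> \<zero> \<zero> \<one> \<in> upper_triangular_GL 3 R"
    using assms(2) by (auto intro!: unipotent_in_upper_triangular)
  show ?thesis unfolding bruhat_def
    by (rule bexI[OF _ 1], rule bexI[OF _ 2]) (use assms in \<open>simp add: mult_GL mat3_mult\<close>)
qed

lemma bruhat_col:
  assumes "{a, b, c, d, e, f, g, h, i} \<subseteq> carrier R" "{x, y, z} \<subseteq> carrier R"
  shows "bruhat (M3 a b c d e f g h i)
    (M3 a (a \<otimes> x \<oplus> b) (a \<otimes> y \<oplus> b \<otimes> z \<oplus> c)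
        d (d \<otimes> x \<oplus> e) (d \<otimes> y \<oplus> e \<otimes> z \<oplus> f)
        g (g \<otimes> x \<oplus> h) (g \<otimes> y \<oplus> h \<otimes> z \<oplus> i))"
proof -
  have 1: "M3 \<one> x y \<zero> \<one> z \<zero> \<zero> \<one> \<in> upper_triangular_GL 3 R"
    and 2: "M3 \<one> \<zero> \<zero> \<zero> \<one> \<zero> \<zero> \<zero> \<one> \<in> upper_triangular_GL 3 R"
    using assms(2) by (auto intro!: unipotent_in_upper_triangular)
  show ?thesis unfolding bruhat_def
    by (rule bexI[OF _ 2], rule bexI[OF _ 1]) (use assms in \<open>simp add: mult_GL mat3_mult\<close>)
qed

lemma bruhat_scale:
  assumes "{a, b, c, d, e, f, g, h, i} \<subseteq> carrier R"
    and "s1 \<in> Units R" "s2 \<in> Units R" "s3 \<in> Units R" "t1 \<in> Units R" "t2 \<in> Units R" "t3 \<in> Units R"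
  shows "bruhat (M3 a b c d e f g h i)
    (M3 (s1 \<otimes> a \<otimes> t1) (s1 \<otimes> b \<otimes> t2) (s1 \<otimes> c \<otimes> t3)
        (s2 \<otimes> d \<otimes> t1) (s2 \<otimes> e \<otimes> t2) (s2 \<otimes> f \<otimes> t3)
        (s3 \<otimes> g \<otimes> t1) (s3 \<otimes> h \<otimes> t2) (s3 \<otimes> i \<otimes> t3))"
proof -
  have c: "{s1, s2, s3, t1, t2, t3} \<subseteq> carrier R" using assms(2-) by auto
  note 1 = diagonal_in_upper_triangular[OF assms(2-4)]
    and 2 = diagonal_in_upper_triangular[OF assms(5-7)]
  show ?thesis unfolding bruhat_def
    by (rule bexI[OF _ 1], rule bexI[OF _ 2]) (use assms(1) c in \<open>simp add: mult_GL mat3_mult\<close>)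
qed

lemma unit_in_unimodular:
  assumes c: "{x, y, z, x', y', z'} \<subseteq> carrier R" and 1: "x \<otimes> x' \<oplus> y \<otimes> y' \<oplus> z \<otimes> z' = \<one>"
  shows "x \<in> Units R \<or> y \<in> Units R \<or> z \<in> Units R"
proof (rule ccontr)
  assume a: "\<not> ?thesis"
  have m: "\<exists>w0\<in>carrier R. w = p \<otimes> w0" if "w \<in> carrier R" "w \<notin> Units R" for w
    using unit_or_multiple[OF that(1)] that(2) by auto
  obtain x0 where x0: "x0 \<in> carrier R" "x = p \<otimes> x0" using m[of x] a c by auto
  obtain y0 where y0: "y0 \<in> carrier R" "y = p \<otimes> y0" using m[of y] a c by auto
  obtain z0 where z0: "z0 \<in> carrier R" "z = p \<otimes> z0" using m[of z] a c by auto
  have "\<one> = p \<otimes> x0 \<otimes> x' \<oplus> p \<otimes> y0 \<otimes> y' \<oplus> p \<otimes> z0 \<otimes> z'"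
    using 1 unfolding x0(2) y0(2) z0(2) by simp
  also have "\<dots> = p \<otimes> (x0 \<otimes> x' \<oplus> y0 \<otimes> y' \<oplus> z0 \<otimes> z')"
    using c x0(1) y0(1) z0(1) by (simp add: r_distr m_assoc)
  finally show False
    using one_not_multiple[of "x0 \<otimes> x' \<oplus> y0 \<otimes> y' \<oplus> z0 \<otimes> z'"] c x0(1) y0(1) z0(1) by simp
qed

lemma GL3_units:
  assumes "M3 a b c d e f g h i \<in> carrier (GL 3 R)"
  shows "{a, b, c, d, e, f, g, h, i} \<subseteq> carrier R"
    and "a \<in> Units R \<or> b \<in> Units R \<or> c \<in> Units R"
    and "d \<in> Units R \<or> e \<in> Units R \<or> f \<in> Units R"
    and "g \<in> Units R \<or> h \<in> Units R \<or> i \<in> Units R"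
    and "a \<in> Units R \<or> d \<in> Units R \<or> g \<in> Units R"
    and "b \<in> Units R \<or> e \<in> Units R \<or> h \<in> Units R"
    and "c \<in> Units R \<or> f \<in> Units R \<or> i \<in> Units R"
proof -
  show c: "{a, b, c, d, e, f, g, h, i} \<subseteq> carrier R"
    using monoid.Units_closed[OF mat3_monoid assms[unfolded carrier_GL]] by (simp only: carrier_mat3)
  obtain a' b' c' d' e' f' g' h' i' where N: "{a', b', c', d', e', f', g', h', i'} \<subseteq> carrier R"
    "inv\<^bsub>GL 3 R\<^esub> (M3 a b c d e f g h i) = M3 a' b' c' d' e' f' g' h' i'"
    "M3 a b c d e f g h i \<otimes>\<^bsub>mat_monoid 3 R\<^esub> M3 a' b' c' d' e' f' g' h' i' = M3 \<one> \<zero> \<zero> \<zero> \<one> \<zero> \<zero> \<zero> \<one>"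
    "M3 a' b' c' d' e' f' g' h' i' \<otimes>\<^bsub>mat_monoid 3 R\<^esub> M3 a b c d e f g h i = M3 \<one> \<zero> \<zero> \<zero> \<one> \<zero> \<zero> \<zero> \<one>"
    using GL3_inverse_cases[OF assms] .
  note r = N(3)[unfolded mat3_mult[OF c N(1)] M3_eq_iff]
  note l = N(4)[unfolded mat3_mult[OF N(1) c] M3_eq_iff]
  have cc: "{a, b, c, a', d', g'} \<subseteq> carrier R" "{d, e, f, b', e', h'} \<subseteq> carrier R" "{g, h, i, c', f', i'} \<subseteq> carrier R"
    "{a, d, g, a', b', c'} \<subseteq> carrier R" "{b, e, h, d', e', f'} \<subseteq> carrier R" "{c, f, i, g', h', i'} \<subseteq> carrier R"
    using c N(1) by auto
  show "a \<in> Units R \<or> b \<in> Units R \<or> c \<in> Units R" by (rule unit_in_unimodular[OF cc(1)]) (use r in simp)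
  show "d \<in> Units R \<or> e \<in> Units R \<or> f \<in> Units R" by (rule unit_in_unimodular[OF cc(2)]) (use r in simp)
  show "g \<in> Units R \<or> h \<in> Units R \<or> i \<in> Units R" by (rule unit_in_unimodular[OF cc(3)]) (use r in simp)
  have "a \<otimes> a' \<oplus> d \<otimes> b' \<oplus> g \<otimes> c' = \<one>" "b \<otimes> d' \<oplus> e \<otimes> e' \<oplus> h \<otimes> f' = \<one>" "c \<otimes> g' \<oplus> f \<otimes> h' \<oplus> i \<otimes> i' = \<one>"
    using l c N(1) by (simp_all add: m_comm)
  then show "a \<in> Units R \<or> d \<in> Units R \<or> g \<in> Units R" "b \<in> Units R \<or> e \<in> Units R \<or> h \<in> Units R"
    "c \<in> Units R \<or> f \<in> Units R \<or> i \<in> Units R"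
    using unit_in_unimodular[OF cc(4)] unit_in_unimodular[OF cc(5)] unit_in_unimodular[OF cc(6)] by auto
qed

lemma zero_not_unit [simp]: "\<zero> \<notin> Units R"
  using unit_not_multiple[of \<zero> \<zero>] by auto

lemma cancel_row:
  assumes "g \<in> Units R" "a \<in> carrier R"
  shows "a \<oplus> (\<ominus> (a \<otimes> inv g)) \<otimes> g = \<zero>"
proof -
  have c: "g \<in> carrier R" "inv g \<in> carrier R" using assms by auto
  have "a \<oplus> (\<ominus> (a \<otimes> inv g)) \<otimes> g = a \<ominus> a \<otimes> (g \<otimes> inv g)" using c assms(2) by algebra
  then show ?thesis using assms by (simp add: minus_eq r_neg)
qed

lemma cancel_col:
  assumes "g \<in> Units R" "a \<in> carrier R"
  shows "g \<otimes> (\<ominus> (inv g \<otimes> a)) \<oplus> a = \<zero>"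
proof -
  have c: "g \<in> carrier R" "inv g \<in> carrier R" using assms by auto
  have "g \<otimes> (\<ominus> (inv g \<otimes> a)) \<oplus> a = a \<ominus> a \<otimes> (g \<otimes> inv g)" using c assms(2) by algebra
  then show ?thesis using assms by (simp add: minus_eq r_neg)
qed

definition covered :: "(nat \<times> nat \<Rightarrow> 'a) set \<Rightarrow> (nat \<times> nat \<Rightarrow> 'a) \<Rightarrow> bool"
  where "covered F M \<longleftrightarrow> (M \<in> carrier (GL 3 R) \<longrightarrow> (\<exists>N\<in>F. bruhat M N))"

lemma covered_step:
  assumes "bruhat M N" "covered F N"
  shows "covered F M"
  unfolding covered_def
proof
  assume M: "M \<in> carrier (GL 3 R)"
  then have "\<exists>N'\<in>F. bruhat N N'" using assms bruhat_closed unfolding covered_def by simp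
  then obtain N' where "N' \<in> F" "bruhat N N'" by (elim bexE)
  then show "\<exists>N'\<in>F. bruhat M N'" using bruhat_trans[OF M assms(1)] by (intro bexI)
qed

lemma coveredI:
  assumes "bruhat M N" "N \<in> F"
  shows "covered F M"
  unfolding covered_def using assms by (intro impI bexI[of _ N])

lemma covered_rule:
  assumes "M \<in> carrier (GL 3 R) \<Longrightarrow> covered F M"
  shows "covered F M"
  unfolding covered_def
proof
  assume M: "M \<in> carrier (GL 3 R)"
  show "\<exists>N\<in>F. bruhat M N" using assms[OF M] M unfolding covered_def by (rule mp)
qed

definition unit_leaves :: "(nat \<times> nat \<Rightarrow> 'a) set"
  where "unit_leaves =
    (\<lambda>(i, j). M3 \<zero> \<zero> \<one> \<zero> \<one> \<zero> \<one> \<zero> \<zero>) ` ({..k} \<times> {..k}) \<union>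
    (\<lambda>(i, j). M3 \<zero> \<one> \<zero> \<zero> (p [^] i) \<one> \<one> \<zero> \<zero>) ` ({..k} \<times> {..k}) \<union>
    (\<lambda>(i, j). M3 \<zero> \<zero> \<one> \<one> \<zero> \<zero> (p [^] i) \<one> \<zero>) ` ({..k} \<times> {..k}) \<union>
    (\<lambda>(i, j). M3 \<one> \<zero> \<zero> (p [^] i) \<zero> \<one> (p [^] j) \<one> \<zero>) ` ({..k} \<times> {..k}) \<union>
    (\<lambda>(i, j). M3 \<zero> \<one> \<zero> \<one> \<zero> \<zero> (p [^] i) (p [^] j) \<one>) ` ({..k} \<times> {..k})"

lemma unit_leavesI:
  assumes "i \<le> k" "j \<le> k"
  shows "M3 \<zero> \<zero> \<one> \<zero> \<one> \<zero> \<one> \<zero> \<zero> \<in> unit_leaves"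
    and "M3 \<zero> \<one> \<zero> \<zero> (p [^] i) \<one> \<one> \<zero> \<zero> \<in> unit_leaves"
    and "M3 \<zero> \<zero> \<one> \<one> \<zero> \<zero> (p [^] i) \<one> \<zero> \<in> unit_leaves"
    and "M3 \<one> \<zero> \<zero> (p [^] i) \<zero> \<one> (p [^] j) \<one> \<zero> \<in> unit_leaves"
    and "M3 \<zero> \<one> \<zero> \<one> \<zero> \<zero> (p [^] i) (p [^] j) \<one> \<in> unit_leaves"
proof -
  have ij: "(i, j) \<in> {..k} \<times> {..k}" using assms by simp
  have "M3 \<zero> \<zero> \<one> \<zero> \<one> \<zero> \<one> \<zero> \<zero> \<in> (\<lambda>(i, j). M3 \<zero> \<zero> \<one> \<zero> \<one> \<zero> \<one> \<zero> \<zero>) ` ({..k} \<times> {..k})"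
    by (rule image_eqI[OF _ ij]) simp
  then show "M3 \<zero> \<zero> \<one> \<zero> \<one> \<zero> \<one> \<zero> \<zero> \<in> unit_leaves" unfolding unit_leaves_def by (simp only: Un_iff simp_thms)
  have "M3 \<zero> \<one> \<zero> \<zero> (p [^] i) \<one> \<one> \<zero> \<zero> \<in> (\<lambda>(i, j). M3 \<zero> \<one> \<zero> \<zero> (p [^] i) \<one> \<one> \<zero> \<zero>) ` ({..k} \<times> {..k})"
    by (rule image_eqI[OF _ ij]) simp
  then show "M3 \<zero> \<one> \<zero> \<zero> (p [^] i) \<one> \<one> \<zero> \<zero> \<in> unit_leaves" unfolding unit_leaves_def by (simp only: Un_iff simp_thms)
  have "M3 \<zero> \<zero> \<one> \<one> \<zero> \<zero> (p [^] i) \<one> \<zero> \<in> (\<lambda>(i, j). M3 \<zero> \<zero> \<one> \<one> \<zero> \<zero> (p [^] i) \<one> \<zero>) ` ({..k} \<times> {..k})"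
    by (rule image_eqI[OF _ ij]) simp
  then show "M3 \<zero> \<zero> \<one> \<one> \<zero> \<zero> (p [^] i) \<one> \<zero> \<in> unit_leaves" unfolding unit_leaves_def by (simp only: Un_iff simp_thms)
  have "M3 \<one> \<zero> \<zero> (p [^] i) \<zero> \<one> (p [^] j) \<one> \<zero> \<in> (\<lambda>(i, j). M3 \<one> \<zero> \<zero> (p [^] i) \<zero> \<one> (p [^] j) \<one> \<zero>) ` ({..k} \<times> {..k})"
    by (rule image_eqI[OF _ ij]) simp
  then show "M3 \<one> \<zero> \<zero> (p [^] i) \<zero> \<one> (p [^] j) \<one> \<zero> \<in> unit_leaves" unfolding unit_leaves_def by (simp only: Un_iff simp_thms)
  have "M3 \<zero> \<one> \<zero> \<one> \<zero> \<zero> (p [^] i) (p [^] j) \<one> \<in> (\<lambda>(i, j). M3 \<zero> \<one> \<zero> \<one> \<zero> \<zero> (p [^] i) (p [^] j) \<one>) ` ({..k} \<times> {..k})"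
    by (rule image_eqI[OF _ ij]) simp
  then show "M3 \<zero> \<one> \<zero> \<one> \<zero> \<zero> (p [^] i) (p [^] j) \<one> \<in> unit_leaves" unfolding unit_leaves_def by (simp only: Un_iff simp_thms)
qed

lemma finite_unit_leaves: "finite unit_leaves"
  unfolding unit_leaves_def by simp

lemma card_unit_leaves: "card unit_leaves \<le> 5 * (k + 1)\<^sup>2"
proof -
  have 1: "card (\<phi> ` ({..k} \<times> {..k})) \<le> (k + 1)\<^sup>2" for \<phi> :: "nat \<times> nat \<Rightarrow> nat \<times> nat \<Rightarrow> 'a"
    by (rule order.trans[OF card_image_le]) (simp_all add: power2_eq_square)
  have 2: "card (A \<union> B) \<le> m + n" if "card A \<le> m" "card B \<le> n" for A B :: "(nat \<times> nat \<Rightarrow> 'a) set" and m n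
    using that card_Un_le[of A B] by linarith
  have "card unit_leaves \<le> (k + 1)\<^sup>2 + (k + 1)\<^sup>2 + (k + 1)\<^sup>2 + (k + 1)\<^sup>2 + (k + 1)\<^sup>2"
    unfolding unit_leaves_def by (intro 2 1)
  then show ?thesis by simp
qed

lemma inverse_cancel:
  assumes "u \<in> Units R" "x \<in> carrier R"
  shows "inv u \<otimes> u = \<one>" "inv u \<otimes> (u \<otimes> x) = x" "u \<otimes> (inv u \<otimes> x) = x"
proof -
  have "u \<in> carrier R" "inv u \<in> carrier R" using assms by auto
  then show "inv u \<otimes> u = \<one>" "inv u \<otimes> (u \<otimes> x) = x" "u \<otimes> (inv u \<otimes> x) = x"
    using assms by (simp_all add: m_assoc[symmetric])
qed

lemma covered_corner_unit:
  assumes g: "g \<in> Units R"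
  shows "covered unit_leaves (M3 a b c d e f g h i)"
proof (rule covered_rule)
  assume GL: "M3 a b c d e f g h i \<in> carrier (GL 3 R)"
  note cs = GL3_units(1)[OF GL]
  have gc: "g \<in> carrier R" "inv g \<in> carrier R" using g by auto
  define y z where "y = \<ominus> (a \<otimes> inv g)" and "z = \<ominus> (d \<otimes> inv g)"
  have yz: "{\<zero>, y, z} \<subseteq> carrier R" using cs gc by (simp add: y_def z_def)
  define b1 c1 e1 f1 where "b1 = b \<oplus> \<zero> \<otimes> e \<oplus> y \<otimes> h" and "c1 = c \<oplus> \<zero> \<otimes> f \<oplus> y \<otimes> i"
    and "e1 = e \<oplus> z \<otimes> h" and "f1 = f \<oplus> z \<otimes> i"
  have cs1: "b1 \<in> carrier R" "c1 \<in> carrier R" "e1 \<in> carrier R" "f1 \<in> carrier R"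
    using cs yz by (simp_all add: b1_def c1_def e1_def f1_def)
  have "a \<oplus> \<zero> \<otimes> d \<oplus> y \<otimes> g = \<zero>" "d \<oplus> z \<otimes> g = \<zero>"
    using cancel_row[OF g, of a] cancel_row[OF g, of d] cs unfolding y_def z_def by simp_all
  then have s1: "bruhat (M3 a b c d e f g h i) (M3 \<zero> b1 c1 \<zero> e1 f1 g h i)"
    using bruhat_row[OF cs yz] unfolding b1_def c1_def e1_def f1_def by simp
  define x' y' where "x' = \<ominus> (inv g \<otimes> h)" and "y' = \<ominus> (inv g \<otimes> i)"
  have xy': "{x', y', \<zero>} \<subseteq> carrier R" using cs gc by (simp add: x'_def y'_def)
  have "g \<otimes> x' \<oplus> h = \<zero>" "g \<otimes> y' \<oplus> i = \<zero>" using cancel_col[OF g] cs unfolding x'_def y'_def by simp_all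
  then have s2: "bruhat (M3 \<zero> b1 c1 \<zero> e1 f1 g h i) (M3 \<zero> b1 c1 \<zero> e1 f1 g \<zero> \<zero>)"
    using bruhat_col[of \<zero> b1 c1 \<zero> e1 f1 g h i x' y' \<zero>] cs1 xy' cs by simp
  have "covered unit_leaves (M3 \<zero> b1 c1 \<zero> e1 f1 g \<zero> \<zero>)"
  proof (cases "e1 \<in> Units R")
    case True
    then have ei: "inv e1 \<in> carrier R" by auto
    define x where "x = \<ominus> (b1 \<otimes> inv e1)"
    have x: "x \<in> carrier R" using cs1 ei by (simp add: x_def)
    define c2 where "c2 = c1 \<oplus> x \<otimes> f1"
    have c2: "c2 \<in> carrier R" using cs1 x by (simp add: c2_def)
    have "b1 \<oplus> x \<otimes> e1 = \<zero>" using cancel_row[OF True] cs1 unfolding x_def by simp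
    then have s3: "bruhat (M3 \<zero> b1 c1 \<zero> e1 f1 g \<zero> \<zero>) (M3 \<zero> \<zero> c2 \<zero> e1 f1 g \<zero> \<zero>)"
      using bruhat_row[of \<zero> b1 c1 \<zero> e1 f1 g \<zero> \<zero> x \<zero> \<zero>] cs1 x gc unfolding c2_def by simp
    have "e1 \<otimes> (\<ominus> (inv e1 \<otimes> f1)) \<oplus> f1 = \<zero>" using cancel_col[OF True] cs1 by simp
    then have s4: "bruhat (M3 \<zero> \<zero> c2 \<zero> e1 f1 g \<zero> \<zero>) (M3 \<zero> \<zero> c2 \<zero> e1 \<zero> g \<zero> \<zero>)"
      using bruhat_col[of \<zero> \<zero> c2 \<zero> e1 f1 g \<zero> \<zero> \<zero> \<zero> "\<ominus> (inv e1 \<otimes> f1)"] cs1 c2 ei gc by simp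
    have "covered unit_leaves (M3 \<zero> \<zero> c2 \<zero> e1 \<zero> g \<zero> \<zero>)"
    proof (rule covered_rule)
      assume "M3 \<zero> \<zero> c2 \<zero> e1 \<zero> g \<zero> \<zero> \<in> carrier (GL 3 R)"
      from GL3_units(2)[OF this] have c2u: "c2 \<in> Units R" by simp
      have "bruhat (M3 \<zero> \<zero> c2 \<zero> e1 \<zero> g \<zero> \<zero>) (M3 \<zero> \<zero> \<one> \<zero> \<one> \<zero> \<one> \<zero> \<zero>)"
        using bruhat_scale[of \<zero> \<zero> c2 \<zero> e1 \<zero> g \<zero> \<zero> "inv c2" "inv e1" "inv g" \<one> \<one> \<one>] c2u True g c2 cs1 gc
        by simp
      then show "covered unit_leaves (M3 \<zero> \<zero> c2 \<zero> e1 \<zero> g \<zero> \<zero>)"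
        by (rule coveredI) (rule unit_leavesI(1)[OF le0 le0])
    qed
    then show ?thesis by (rule covered_step[OF s3 covered_step[OF s4]])
  next
    case False
    show ?thesis
    proof (rule covered_rule)
      assume "M3 \<zero> b1 c1 \<zero> e1 f1 g \<zero> \<zero> \<in> carrier (GL 3 R)"
      from GL3_units(6)[OF this] False have b1: "b1 \<in> Units R" by simp
      then have bi: "inv b1 \<in> carrier R" by auto
      define z' where "z' = \<ominus> (inv b1 \<otimes> c1)"
      have z': "z' \<in> carrier R" using bi cs1 by (simp add: z'_def)
      define f2 where "f2 = e1 \<otimes> z' \<oplus> f1"
      have f2: "f2 \<in> carrier R" using cs1 z' by (simp add: f2_def)
      have "b1 \<otimes> z' \<oplus> c1 = \<zero>" using cancel_col[OF b1] cs1 unfolding z'_def by simp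
      then have s3: "bruhat (M3 \<zero> b1 c1 \<zero> e1 f1 g \<zero> \<zero>) (M3 \<zero> b1 \<zero> \<zero> e1 f2 g \<zero> \<zero>)"
        using bruhat_col[of \<zero> b1 c1 \<zero> e1 f1 g \<zero> \<zero> \<zero> \<zero> z'] cs1 z' gc unfolding f2_def by simp
      have "covered unit_leaves (M3 \<zero> b1 \<zero> \<zero> e1 f2 g \<zero> \<zero>)"
      proof (rule covered_rule)
        assume "M3 \<zero> b1 \<zero> \<zero> e1 f2 g \<zero> \<zero> \<in> carrier (GL 3 R)"
        from GL3_units(3)[OF this] False have f2u: "f2 \<in> Units R" by simp
        obtain u j where u: "u \<in> Units R" "j \<le> k" "e1 = u \<otimes> p [^] j" using unit_times_power[OF cs1(3)] by auto
        have uc: "u \<in> carrier R" "inv u \<in> carrier R" "inv f2 \<in> carrier R" using u f2u by auto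
        have "inv u \<otimes> f2 \<otimes> (inv f2 \<otimes> u) = \<one>"
          using uc f2 inverse_cancel[OF f2u, of u] inverse_cancel[OF u(1), of u] by (simp add: m_assoc)
        moreover have "inv u \<otimes> e1 = p [^] j" using u inverse_cancel[OF u(1), of "p [^] j"] by simp
        ultimately have "bruhat (M3 \<zero> b1 \<zero> \<zero> e1 f2 g \<zero> \<zero>) (M3 \<zero> \<one> \<zero> \<zero> (p [^] j) \<one> \<one> \<zero> \<zero>)"
          using bruhat_scale[of \<zero> b1 \<zero> \<zero> e1 f2 g \<zero> \<zero> "inv b1" "inv u" "inv g" \<one> \<one> "inv f2 \<otimes> u"]
            b1 u(1) g f2u cs1 gc bi uc f2 by simp
        then show "covered unit_leaves (M3 \<zero> b1 \<zero> \<zero> e1 f2 g \<zero> \<zero>)"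
          by (rule coveredI) (rule unit_leavesI(2)[OF u(2) le0])
      qed
      then show "covered unit_leaves (M3 \<zero> b1 c1 \<zero> e1 f1 g \<zero> \<zero>)" by (rule covered_step[OF s3])
    qed
  qed
  then show "covered unit_leaves (M3 a b c d e f g h i)" by (rule covered_step[OF s1 covered_step[OF s2]])
qed

lemma covered_bottom_middle_unit:
  assumes g: "g \<notin> Units R" and h: "h \<in> Units R"
  shows "covered unit_leaves (M3 a b c d e f g h i)"
proof (rule covered_rule)
  assume GL: "M3 a b c d e f g h i \<in> carrier (GL 3 R)"
  note cs = GL3_units(1)[OF GL]
  have gc: "g \<in> carrier R" "h \<in> carrier R" "inv h \<in> carrier R" using h cs by auto
  define y z where "y = \<ominus> (b \<otimes> inv h)" and "z = \<ominus> (e \<otimes> inv h)"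
  have yz: "{\<zero>, y, z} \<subseteq> carrier R" using cs gc by (simp add: y_def z_def)
  define a1 c1 d1 f1 where "a1 = a \<oplus> \<zero> \<otimes> d \<oplus> y \<otimes> g" and "c1 = c \<oplus> \<zero> \<otimes> f \<oplus> y \<otimes> i"
    and "d1 = d \<oplus> z \<otimes> g" and "f1 = f \<oplus> z \<otimes> i"
  have cs1: "a1 \<in> carrier R" "c1 \<in> carrier R" "d1 \<in> carrier R" "f1 \<in> carrier R"
    using cs yz by (simp_all add: a1_def c1_def d1_def f1_def)
  have "b \<oplus> \<zero> \<otimes> e \<oplus> y \<otimes> h = \<zero>" "e \<oplus> z \<otimes> h = \<zero>"
    using cancel_row[OF h, of b] cancel_row[OF h, of e] cs unfolding y_def z_def by simp_all
  then have s1: "bruhat (M3 a b c d e f g h i) (M3 a1 \<zero> c1 d1 \<zero> f1 g h i)"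
    using bruhat_row[OF cs yz] unfolding a1_def c1_def d1_def f1_def by simp
  define z' where "z' = \<ominus> (inv h \<otimes> i)"
  have z': "z' \<in> carrier R" using cs gc by (simp add: z'_def)
  have "h \<otimes> z' \<oplus> i = \<zero>" using cancel_col[OF h] cs unfolding z'_def by simp
  then have s2: "bruhat (M3 a1 \<zero> c1 d1 \<zero> f1 g h i) (M3 a1 \<zero> c1 d1 \<zero> f1 g h \<zero>)"
    using bruhat_col[of a1 \<zero> c1 d1 \<zero> f1 g h i \<zero> \<zero> z'] cs1 z' cs by simp
  have "covered unit_leaves (M3 a1 \<zero> c1 d1 \<zero> f1 g h \<zero>)"
  proof (cases "d1 \<in> Units R")
    case True
    then have di: "inv d1 \<in> carrier R" by auto
    define x where "x = \<ominus> (a1 \<otimes> inv d1)"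
    have x: "x \<in> carrier R" using cs1 di by (simp add: x_def)
    define c2 where "c2 = c1 \<oplus> x \<otimes> f1"
    have c2: "c2 \<in> carrier R" using cs1 x by (simp add: c2_def)
    have "a1 \<oplus> x \<otimes> d1 = \<zero>" using cancel_row[OF True] cs1 unfolding x_def by simp
    then have s3: "bruhat (M3 a1 \<zero> c1 d1 \<zero> f1 g h \<zero>) (M3 \<zero> \<zero> c2 d1 \<zero> f1 g h \<zero>)"
      using bruhat_row[of a1 \<zero> c1 d1 \<zero> f1 g h \<zero> x \<zero> \<zero>] cs1 x gc unfolding c2_def by simp
    define y' z'' where "y' = \<ominus> (inv d1 \<otimes> f1)" and "z'' = \<ominus> (inv h \<otimes> (g \<otimes> y'))"
    have yz': "y' \<in> carrier R" "z'' \<in> carrier R" using di cs1 gc by (simp_all add: y'_def z''_def)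
    have "d1 \<otimes> y' \<oplus> f1 = \<zero>" using cancel_col[OF True] cs1 unfolding y'_def by simp
    moreover have "g \<otimes> y' \<oplus> h \<otimes> z'' = \<zero>"
      using cancel_col[OF h, of "g \<otimes> y'"] gc yz' unfolding z''_def by (simp add: a_comm)
    ultimately have s4: "bruhat (M3 \<zero> \<zero> c2 d1 \<zero> f1 g h \<zero>) (M3 \<zero> \<zero> c2 d1 \<zero> \<zero> g h \<zero>)"
      using bruhat_col[of \<zero> \<zero> c2 d1 \<zero> f1 g h \<zero> \<zero> y' z''] cs1 c2 yz' gc by simp
    have "covered unit_leaves (M3 \<zero> \<zero> c2 d1 \<zero> \<zero> g h \<zero>)"
    proof (rule covered_rule)
      assume "M3 \<zero> \<zero> c2 d1 \<zero> \<zero> g h \<zero> \<in> carrier (GL 3 R)"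
      from GL3_units(2)[OF this] have c2u: "c2 \<in> Units R" by simp
      obtain u j where u: "u \<in> Units R" "j \<le> k" "g = u \<otimes> p [^] j" using unit_times_power[OF gc(1)] by auto
      have uc: "u \<in> carrier R" "inv u \<in> carrier R" using u by auto
      have "inv u \<otimes> h \<otimes> (inv h \<otimes> u) = \<one>"
        using uc gc inverse_cancel[OF h, of u] inverse_cancel[OF u(1), of u] by (simp add: m_assoc)
      moreover have "inv u \<otimes> g = p [^] j" using u inverse_cancel[OF u(1), of "p [^] j"] by simp
      ultimately have "bruhat (M3 \<zero> \<zero> c2 d1 \<zero> \<zero> g h \<zero>) (M3 \<zero> \<zero> \<one> \<one> \<zero> \<zero> (p [^] j) \<one> \<zero>)"
        using bruhat_scale[of \<zero> \<zero> c2 d1 \<zero> \<zero> g h \<zero> "inv c2" "inv d1" "inv u" \<one> "inv h \<otimes> u" \<one>]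
          c2u True h u(1) c2 cs1 gc uc di by simp
      then show "covered unit_leaves (M3 \<zero> \<zero> c2 d1 \<zero> \<zero> g h \<zero>)"
        by (rule coveredI) (rule unit_leavesI(3)[OF u(2) le0])
    qed
    then show ?thesis by (rule covered_step[OF s3 covered_step[OF s4]])
  next
    case False
    show ?thesis
    proof (rule covered_rule)
      assume "M3 a1 \<zero> c1 d1 \<zero> f1 g h \<zero> \<in> carrier (GL 3 R)"
      from GL3_units(5)[OF this] False g have a1: "a1 \<in> Units R" by simp
      then have ai: "inv a1 \<in> carrier R" by auto
      define y' z'' where "y' = \<ominus> (inv a1 \<otimes> c1)" and "z'' = \<ominus> (inv h \<otimes> (g \<otimes> y'))"
      have yz': "y' \<in> carrier R" "z'' \<in> carrier R" using ai cs1 gc by (simp_all add: y'_def z''_def)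
      define f2 where "f2 = d1 \<otimes> y' \<oplus> f1"
      have f2: "f2 \<in> carrier R" using cs1 yz' by (simp add: f2_def)
      have "a1 \<otimes> y' \<oplus> c1 = \<zero>" using cancel_col[OF a1] cs1 unfolding y'_def by simp
      moreover have "g \<otimes> y' \<oplus> h \<otimes> z'' = \<zero>"
        using cancel_col[OF h, of "g \<otimes> y'"] gc yz' unfolding z''_def by (simp add: a_comm)
      ultimately have s3: "bruhat (M3 a1 \<zero> c1 d1 \<zero> f1 g h \<zero>) (M3 a1 \<zero> \<zero> d1 \<zero> f2 g h \<zero>)"
        using bruhat_col[of a1 \<zero> c1 d1 \<zero> f1 g h \<zero> \<zero> y' z''] cs1 yz' gc unfolding f2_def by simp
      have "covered unit_leaves (M3 a1 \<zero> \<zero> d1 \<zero> f2 g h \<zero>)"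
      proof (rule covered_rule)
        assume "M3 a1 \<zero> \<zero> d1 \<zero> f2 g h \<zero> \<in> carrier (GL 3 R)"
        from GL3_units(3)[OF this] False have f2u: "f2 \<in> Units R" by simp
        obtain u m where u: "u \<in> Units R" "m \<le> k" "d1 = u \<otimes> p [^] m" using unit_times_power[OF cs1(3)] by auto
        obtain v n where v: "v \<in> Units R" "n \<le> k" "g = v \<otimes> p [^] n" using unit_times_power[OF gc(1)] by auto
        have uc: "u \<in> carrier R" "inv u \<in> carrier R" "inv f2 \<in> carrier R" "v \<in> carrier R" "inv v \<in> carrier R"
          using u v f2u by auto
        have "inv u \<otimes> f2 \<otimes> (inv f2 \<otimes> u) = \<one>"
          using uc f2 inverse_cancel[OF f2u, of u] inverse_cancel[OF u(1), of u] by (simp add: m_assoc)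
        moreover have "inv v \<otimes> h \<otimes> (inv h \<otimes> v) = \<one>"
          using uc gc inverse_cancel[OF h, of v] inverse_cancel[OF v(1), of v] by (simp add: m_assoc)
        moreover have "inv u \<otimes> d1 = p [^] m" using u inverse_cancel[OF u(1), of "p [^] m"] by simp
        moreover have "inv v \<otimes> g = p [^] n" using v inverse_cancel[OF v(1), of "p [^] n"] by simp
        ultimately have "bruhat (M3 a1 \<zero> \<zero> d1 \<zero> f2 g h \<zero>) (M3 \<one> \<zero> \<zero> (p [^] m) \<zero> \<one> (p [^] n) \<one> \<zero>)"
          using bruhat_scale[of a1 \<zero> \<zero> d1 \<zero> f2 g h \<zero> "inv a1" "inv u" "inv v" \<one> "inv h \<otimes> v" "inv f2 \<otimes> u"]
            a1 u(1) v(1) h f2u cs1 gc ai uc f2 by simp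
        then show "covered unit_leaves (M3 a1 \<zero> \<zero> d1 \<zero> f2 g h \<zero>)"
          by (rule coveredI) (rule unit_leavesI(4)[OF u(2) v(2)])
      qed
      then show "covered unit_leaves (M3 a1 \<zero> c1 d1 \<zero> f1 g h \<zero>)" by (rule covered_step[OF s3])
    qed
  qed
  then show "covered unit_leaves (M3 a b c d e f g h i)" by (rule covered_step[OF s1 covered_step[OF s2]])
qed

lemma covered_mono: "\<lbrakk>covered F M; F \<subseteq> F'\<rbrakk> \<Longrightarrow> covered F' M"
  unfolding covered_def by auto

abbreviation lower_unipotent :: "'a \<Rightarrow> 'a \<Rightarrow> 'a \<Rightarrow> nat \<times> nat \<Rightarrow> 'a"
  where "lower_unipotent a b c \<equiv> M3 \<one> \<zero> \<zero> a \<one> \<zero> c b \<one>"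

lemma nonunit_scale:
  assumes "x \<in> carrier R" "x \<notin> Units R" "y \<in> carrier R"
  shows "y \<otimes> x \<notin> Units R"
proof
  assume a: "y \<otimes> x \<in> Units R"
  obtain x' where x': "x' \<in> carrier R" "x = p \<otimes> x'" using unit_or_multiple[OF assms(1)] assms(2) by auto
  have "y \<otimes> x = p \<otimes> (y \<otimes> x')" unfolding x'(2) using x'(1) assms(3) p_closed by algebra
  then show False using unit_not_multiple[OF a, of "y \<otimes> x'"] x' assms by simp
qed

lemma nonunit_add:
  assumes "x \<in> carrier R" "x \<notin> Units R" "y \<in> carrier R" "y \<notin> Units R"
  shows "x \<oplus> y \<notin> Units R"
proof
  assume a: "x \<oplus> y \<in> Units R"
  obtain x' where x': "x' \<in> carrier R" "x = p \<otimes> x'" using unit_or_multiple[OF assms(1)] assms(2) by auto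
  obtain y' where y': "y' \<in> carrier R" "y = p \<otimes> y'" using unit_or_multiple[OF assms(3)] assms(4) by auto
  have "x \<oplus> y = p \<otimes> (x' \<oplus> y')" unfolding x'(2) y'(2) using x'(1) y'(1) p_closed by algebra
  then show False using unit_not_multiple[OF a, of "x' \<oplus> y'"] x' y' by simp
qed

lemma covered_bottom_right_unit:
  assumes g: "g \<notin> Units R" and h: "h \<notin> Units R" and i: "i \<in> Units R"
    and F: "unit_leaves \<subseteq> F"
      "\<And>a b c. \<lbrakk>{a, b, c} \<subseteq> carrier R; a \<notin> Units R; b \<notin> Units R\<rbrakk> \<Longrightarrow> covered F (lower_unipotent a b c)"
  shows "covered F (M3 a b c d e f g h i)"
proof (rule covered_rule)
  assume GL: "M3 a b c d e f g h i \<in> carrier (GL 3 R)"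
  note cs = GL3_units(1)[OF GL]
  have gc: "g \<in> carrier R" "h \<in> carrier R" "i \<in> carrier R" "inv i \<in> carrier R" using i cs by auto
  define y z where "y = \<ominus> (c \<otimes> inv i)" and "z = \<ominus> (f \<otimes> inv i)"
  have yz: "{\<zero>, y, z} \<subseteq> carrier R" using cs gc by (simp add: y_def z_def)
  define a1 b1 d1 e1 where "a1 = a \<oplus> \<zero> \<otimes> d \<oplus> y \<otimes> g" and "b1 = b \<oplus> \<zero> \<otimes> e \<oplus> y \<otimes> h"
    and "d1 = d \<oplus> z \<otimes> g" and "e1 = e \<oplus> z \<otimes> h"
  have cs1: "a1 \<in> carrier R" "b1 \<in> carrier R" "d1 \<in> carrier R" "e1 \<in> carrier R"
    using cs yz by (simp_all add: a1_def b1_def d1_def e1_def)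
  have "c \<oplus> \<zero> \<otimes> f \<oplus> y \<otimes> i = \<zero>" "f \<oplus> z \<otimes> i = \<zero>"
    using cancel_row[OF i, of c] cancel_row[OF i, of f] cs unfolding y_def z_def by simp_all
  then have s1: "bruhat (M3 a b c d e f g h i) (M3 a1 b1 \<zero> d1 e1 \<zero> g h i)"
    using bruhat_row[OF cs yz] unfolding a1_def b1_def d1_def e1_def by simp
  have "covered F (M3 a1 b1 \<zero> d1 e1 \<zero> g h i)"
  proof (cases "d1 \<in> Units R")
    case True
    then have di: "inv d1 \<in> carrier R" by auto
    define x where "x = \<ominus> (a1 \<otimes> inv d1)"
    have x: "x \<in> carrier R" using cs1 di by (simp add: x_def)
    define b2 where "b2 = b1 \<oplus> x \<otimes> e1"
    have b2: "b2 \<in> carrier R" using cs1 x by (simp add: b2_def)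
    have "a1 \<oplus> x \<otimes> d1 = \<zero>" using cancel_row[OF True] cs1 unfolding x_def by simp
    then have s3: "bruhat (M3 a1 b1 \<zero> d1 e1 \<zero> g h i) (M3 \<zero> b2 \<zero> d1 e1 \<zero> g h i)"
      using bruhat_row[of a1 b1 \<zero> d1 e1 \<zero> g h i x \<zero> \<zero>] cs1 x gc unfolding b2_def by simp
    define x' where "x' = \<ominus> (inv d1 \<otimes> e1)"
    have x': "x' \<in> carrier R" using di cs1 by (simp add: x'_def)
    define h2 where "h2 = g \<otimes> x' \<oplus> h"
    have h2: "h2 \<in> carrier R" using x' gc by (simp add: h2_def)
    have "d1 \<otimes> x' \<oplus> e1 = \<zero>" using cancel_col[OF True] cs1 unfolding x'_def by simp
    then have s4: "bruhat (M3 \<zero> b2 \<zero> d1 e1 \<zero> g h i) (M3 \<zero> b2 \<zero> d1 \<zero> \<zero> g h2 i)"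
      using bruhat_col[of \<zero> b2 \<zero> d1 e1 \<zero> g h i x' \<zero> \<zero>] cs1 b2 x' gc unfolding h2_def by simp
    have "covered unit_leaves (M3 \<zero> b2 \<zero> d1 \<zero> \<zero> g h2 i)"
    proof (rule covered_rule)
      assume "M3 \<zero> b2 \<zero> d1 \<zero> \<zero> g h2 i \<in> carrier (GL 3 R)"
      from GL3_units(2)[OF this] have b2u: "b2 \<in> Units R" by simp
      obtain u m where u: "u \<in> Units R" "m \<le> k" "g = u \<otimes> p [^] m" using unit_times_power[OF gc(1)] by auto
      obtain v n where v: "v \<in> Units R" "n \<le> k" "h2 = v \<otimes> p [^] n" using unit_times_power[OF h2] by auto
      have uc: "u \<in> carrier R" "inv u \<in> carrier R" "v \<in> carrier R" "inv v \<in> carrier R" "inv b2 \<in> carrier R"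
        using u v b2u by auto
      have "v \<otimes> inv b2 \<otimes> b2 \<otimes> inv v = \<one>"
        using uc b2 v(1) inverse_cancel[OF b2u, of "inv v"] by (simp add: m_assoc)
      moreover have "u \<otimes> inv d1 \<otimes> d1 \<otimes> inv u = \<one>"
        using uc cs1 di u(1) inverse_cancel[OF True, of "inv u"] by (simp add: m_assoc)
      moreover have "g \<otimes> inv u = p [^] m" using u uc gc inverse_cancel[OF u(1), of "p [^] m"] by (simp add: m_comm)
      moreover have "h2 \<otimes> inv v = p [^] n" using v uc h2 inverse_cancel[OF v(1), of "p [^] n"] by (simp add: m_comm)
      ultimately have "bruhat (M3 \<zero> b2 \<zero> d1 \<zero> \<zero> g h2 i) (M3 \<zero> \<one> \<zero> \<one> \<zero> \<zero> (p [^] m) (p [^] n) \<one>)"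
        using bruhat_scale[of \<zero> b2 \<zero> d1 \<zero> \<zero> g h2 i "v \<otimes> inv b2" "u \<otimes> inv d1" \<one> "inv u" "inv v" "inv i"]
          b2u u(1) v(1) True i b2 h2 cs1 gc di uc by simp
      then show "covered unit_leaves (M3 \<zero> b2 \<zero> d1 \<zero> \<zero> g h2 i)"
        by (rule coveredI) (rule unit_leavesI(5)[OF u(2) v(2)])
    qed
    then show ?thesis by (rule covered_step[OF s3 covered_step[OF s4 covered_mono[OF _ F(1)]]])
  next
    case False
    show ?thesis
    proof (rule covered_rule)
      assume "M3 a1 b1 \<zero> d1 e1 \<zero> g h i \<in> carrier (GL 3 R)"
      from GL3_units(5)[OF this] False g have a1: "a1 \<in> Units R" by simp
      then have ai: "inv a1 \<in> carrier R" by auto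
      define x' where "x' = \<ominus> (inv a1 \<otimes> b1)"
      have x': "x' \<in> carrier R" using ai cs1 by (simp add: x'_def)
      define e2 h2 where "e2 = d1 \<otimes> x' \<oplus> e1" and "h2 = g \<otimes> x' \<oplus> h"
      have h2: "e2 \<in> carrier R" "h2 \<in> carrier R" using x' gc cs1 by (simp_all add: e2_def h2_def)
      have h2n: "h2 \<notin> Units R"
        unfolding h2_def using nonunit_add[OF _ nonunit_scale[OF gc(1) g x'] gc(2) h] x' gc by (simp add: m_comm)
      have "a1 \<otimes> x' \<oplus> b1 = \<zero>" using cancel_col[OF a1] cs1 unfolding x'_def by simp
      then have s3: "bruhat (M3 a1 b1 \<zero> d1 e1 \<zero> g h i) (M3 a1 \<zero> \<zero> d1 e2 \<zero> g h2 i)"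
        using bruhat_col[of a1 b1 \<zero> d1 e1 \<zero> g h i x' \<zero> \<zero>] cs1 x' gc unfolding e2_def h2_def by simp
      have "covered F (M3 a1 \<zero> \<zero> d1 e2 \<zero> g h2 i)"
      proof (rule covered_rule)
        assume "M3 a1 \<zero> \<zero> d1 e2 \<zero> g h2 i \<in> carrier (GL 3 R)"
        from GL3_units(3)[OF this] False have e2u: "e2 \<in> Units R" by simp
        then have ei: "inv e2 \<in> carrier R" by auto
        have s4: "bruhat (M3 a1 \<zero> \<zero> d1 e2 \<zero> g h2 i) (lower_unipotent (inv e2 \<otimes> d1) (inv i \<otimes> h2) (inv i \<otimes> g))"
          using bruhat_scale[of a1 \<zero> \<zero> d1 e2 \<zero> g h2 i "inv a1" "inv e2" "inv i" \<one> \<one> \<one>]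
            a1 e2u i cs1 h2 gc ai ei by simp
        have "covered F (lower_unipotent (inv e2 \<otimes> d1) (inv i \<otimes> h2) (inv i \<otimes> g))"
          using nonunit_scale[OF cs1(3) False ei] nonunit_scale[OF h2(2) h2n gc(4)] cs1 h2 gc ei
          by (intro F(2)) simp_all
        then show "covered F (M3 a1 \<zero> \<zero> d1 e2 \<zero> g h2 i)" by (rule covered_step[OF s4])
      qed
      then show "covered F (M3 a1 b1 \<zero> d1 e1 \<zero> g h i)" by (rule covered_step[OF s3])
    qed
  qed
  then show "covered F (M3 a b c d e f g h i)" by (rule covered_step[OF s1])
qed

lemma lower_unipotent_in_GL:
  assumes "{a, b, c} \<subseteq> carrier R"
  shows "lower_unipotent a b c \<in> carrier (GL 3 R)"
proof -
  let ?M = "lower_unipotent a b c"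
  let ?N = "lower_unipotent (\<ominus> a) (\<ominus> b) (b \<otimes> a \<ominus> c)"
  have c: "a \<in> carrier R" "b \<in> carrier R" "c \<in> carrier R" "\<ominus> a \<in> carrier R" "\<ominus> b \<in> carrier R"
    "b \<otimes> a \<ominus> c \<in> carrier R" using assms by auto
  have eqs: "c \<oplus> b \<otimes> (\<ominus> a) \<oplus> (b \<otimes> a \<ominus> c) = \<zero>" "b \<otimes> a \<ominus> c \<oplus> (\<ominus> b) \<otimes> a \<oplus> c = \<zero>"
    "\<ominus> a \<oplus> a = \<zero>" "a \<oplus> \<ominus> a = \<zero>" "\<ominus> b \<oplus> b = \<zero>" "b \<oplus> \<ominus> b = \<zero>"
    using c(1-3) by algebra+
  have "?M \<otimes>\<^bsub>mat_monoid 3 R\<^esub> ?N = \<one>\<^bsub>mat_monoid 3 R\<^esub>"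
    unfolding mat3_one
    by (subst mat3_mult)
      (simp_all only: c insert_subset empty_subsetI zero_closed one_closed simp_thms M3_eq_iff
        l_one r_one l_null r_null l_zero r_zero eqs m_closed)
  moreover have "?N \<otimes>\<^bsub>mat_monoid 3 R\<^esub> ?M = \<one>\<^bsub>mat_monoid 3 R\<^esub>"
    unfolding mat3_one
    by (subst mat3_mult)
      (simp_all only: c insert_subset empty_subsetI zero_closed one_closed simp_thms M3_eq_iff
        l_one r_one l_null r_null l_zero r_zero eqs m_closed)
  ultimately show ?thesis using c by (intro in_GL3I[where N = ?N]) simp_all
qed

lemma lower_unipotent_scale:
  assumes "{a, b, c} \<subseteq> carrier R" "s \<in> Units R" "t \<in> Units R"
  shows "bruhat (lower_unipotent a b c) (lower_unipotent (s \<otimes> a) (t \<otimes> b) (s \<otimes> t \<otimes> c))"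
proof -
  have c: "s \<in> carrier R" "t \<in> carrier R" "inv s \<in> carrier R" "inv t \<in> carrier R" using assms by auto
  have "s \<otimes> inv s = \<one>" "s \<otimes> t \<otimes> (inv s \<otimes> inv t) = \<one>" "s \<otimes> t \<otimes> b \<otimes> inv s = t \<otimes> b"
  proof -
    have 1: "s \<otimes> inv s = \<one>" "t \<otimes> inv t = \<one>" using assms by simp_all
    then show "s \<otimes> inv s = \<one>" by simp
    have "s \<otimes> t \<otimes> (inv s \<otimes> inv t) = (s \<otimes> inv s) \<otimes> (t \<otimes> inv t)"
      "s \<otimes> t \<otimes> b \<otimes> inv s = (s \<otimes> inv s) \<otimes> (t \<otimes> b)" using c assms(1) by (simp_all add: m_ac)
    then show "s \<otimes> t \<otimes> (inv s \<otimes> inv t) = \<one>" "s \<otimes> t \<otimes> b \<otimes> inv s = t \<otimes> b" unfolding 1 using c assms(1) by simp_all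
  qed
  then show ?thesis
    using bruhat_scale[of \<one> \<zero> \<zero> a \<one> \<zero> c b \<one> \<one> s "s \<otimes> t" \<one> "inv s" "inv s \<otimes> inv t"] assms c by simp
qed

lemma lower_unipotent_shear:
  assumes "{a, b, c, x, y} \<subseteq> carrier R" "b = p \<otimes> y"
  shows "bruhat (lower_unipotent a b c) (lower_unipotent (a \<oplus> x \<otimes> c) b (c \<otimes> (\<one> \<oplus> x \<otimes> b)))"
proof -
  have c: "a \<in> carrier R" "b \<in> carrier R" "c \<in> carrier R" "x \<in> carrier R" "y \<in> carrier R" using assms by auto
  define v where "v = \<one> \<oplus> x \<otimes> b"
  have "v = \<one> \<oplus> p \<otimes> (x \<otimes> y)" unfolding v_def assms(2) using c p_closed by algebra
  then have v: "v \<in> Units R" using unit_plus_multiple[of \<one> "x \<otimes> y"] c by simp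
  then have vc: "v \<in> carrier R" "inv v \<in> carrier R" by auto
  have vi: "v \<otimes> inv v = \<one>" using v by simp
  define z where "z = \<ominus> (inv v \<otimes> x)"
  have z: "z \<in> carrier R" using vc c by (simp add: z_def)
  define w where "w = b \<otimes> z \<oplus> \<one>"
  have s1: "bruhat (lower_unipotent a b c) (M3 \<one> \<zero> \<zero> (a \<oplus> x \<otimes> c) v x c b \<one>)"
    using bruhat_row[of \<one> \<zero> \<zero> a \<one> \<zero> c b \<one> \<zero> \<zero> x] c unfolding v_def by simp
  have "v \<otimes> z \<oplus> x = \<zero>" unfolding z_def using cancel_col[OF v c(4)] .
  then have s2: "bruhat (M3 \<one> \<zero> \<zero> (a \<oplus> x \<otimes> c) v x c b \<one>) (M3 \<one> \<zero> \<zero> (a \<oplus> x \<otimes> c) v \<zero> c b w)"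
    using bruhat_col[of \<one> \<zero> \<zero> "a \<oplus> x \<otimes> c" v x c b \<one> \<zero> \<zero> z] c vc z unfolding w_def by simp
  have "v \<otimes> w = v \<ominus> (v \<otimes> inv v) \<otimes> (x \<otimes> b)" unfolding w_def z_def using c vc by algebra
  also have "\<dots> = \<one>" unfolding vi unfolding v_def using c by algebra
  finally have "v \<otimes> w = \<one>" .
  moreover have "w \<in> carrier R" using c z by (simp add: w_def)
  moreover have "v \<otimes> b \<otimes> inv v = b" using inverse_cancel[OF v c(2)] c vc by (simp add: m_ac)
  moreover have "v \<otimes> c = c \<otimes> v" using c vc by (simp add: m_comm)
  ultimately have s3: "bruhat (M3 \<one> \<zero> \<zero> (a \<oplus> x \<otimes> c) v \<zero> c b w) (lower_unipotent (a \<oplus> x \<otimes> c) b (c \<otimes> v))"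
    using bruhat_scale[of \<one> \<zero> \<zero> "a \<oplus> x \<otimes> c" v \<zero> c b w \<one> \<one> v \<one> "inv v" \<one>] c vc v vi by simp
  have GL: "lower_unipotent a b c \<in> carrier (GL 3 R)" using c by (intro lower_unipotent_in_GL) simp
  show ?thesis using bruhat_trans[OF GL s1 bruhat_trans[OF bruhat_closed[OF GL s1] s2 s3]] unfolding v_def .
qed

lemma lower_unipotent_shear':
  assumes "{a, b, c, x, y} \<subseteq> carrier R" "a = p \<otimes> y"
  shows "bruhat (lower_unipotent a b c) (lower_unipotent a (b \<oplus> x \<otimes> c) (c \<otimes> (\<one> \<oplus> x \<otimes> a)))"
proof -
  have c: "a \<in> carrier R" "b \<in> carrier R" "c \<in> carrier R" "x \<in> carrier R" "y \<in> carrier R" using assms by auto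
  define v where "v = \<one> \<oplus> x \<otimes> a"
  have "v = \<one> \<oplus> p \<otimes> (x \<otimes> y)" unfolding v_def assms(2) using c p_closed by algebra
  then have v: "v \<in> Units R" using unit_plus_multiple[of \<one> "x \<otimes> y"] c by simp
  then have vc: "v \<in> carrier R" "inv v \<in> carrier R" by auto
  have vi: "v \<otimes> inv v = \<one>" using v by simp
  define z where "z = \<ominus> (x \<otimes> inv v)"
  have z: "z \<in> carrier R" using vc c by (simp add: z_def)
  define w where "w = \<one> \<oplus> z \<otimes> a"
  have s1: "bruhat (lower_unipotent a b c) (M3 \<one> x \<zero> a v \<zero> c (b \<oplus> x \<otimes> c) \<one>)"
    using bruhat_col[of \<one> \<zero> \<zero> a \<one> \<zero> c b \<one> x \<zero> \<zero>] c unfolding v_def by (simp add: m_comm a_comm)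
  have "x \<oplus> z \<otimes> v = \<zero>" unfolding z_def using cancel_row[OF v c(4)] .
  then have s2: "bruhat (M3 \<one> x \<zero> a v \<zero> c (b \<oplus> x \<otimes> c) \<one>) (M3 w \<zero> \<zero> a v \<zero> c (b \<oplus> x \<otimes> c) \<one>)"
    using bruhat_row[of \<one> x \<zero> a v \<zero> c "b \<oplus> x \<otimes> c" \<one> z \<zero> \<zero>] c vc z unfolding w_def by simp
  have "w \<otimes> v = v \<ominus> (v \<otimes> inv v) \<otimes> (x \<otimes> a)" unfolding w_def z_def using c vc by algebra
  also have "\<dots> = \<one>" unfolding vi unfolding v_def using c by algebra
  finally have "w \<otimes> v = \<one>" .
  moreover have "w \<in> carrier R" using c z by (simp add: w_def)
  moreover have "inv v \<otimes> a \<otimes> v = a" "inv v \<otimes> v = \<one>"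
    using inverse_cancel[OF v c(1)] c vc by (simp_all add: m_ac)
  ultimately have s3: "bruhat (M3 w \<zero> \<zero> a v \<zero> c (b \<oplus> x \<otimes> c) \<one>) (lower_unipotent a (b \<oplus> x \<otimes> c) (c \<otimes> v))"
    using bruhat_scale[of w \<zero> \<zero> a v \<zero> c "b \<oplus> x \<otimes> c" \<one> \<one> "inv v" \<one> v \<one> \<one>] c vc v by simp
  have GL: "lower_unipotent a b c \<in> carrier (GL 3 R)" using c by (intro lower_unipotent_in_GL) simp
  show ?thesis using bruhat_trans[OF GL s1 bruhat_trans[OF bruhat_closed[OF GL s1] s2 s3]] unfolding v_def .
qed

end

section \<open>Bounds over a finite chain ring\<close>

context finite_chain_ring
begin

lemma nonunit_power:
  assumes "x \<in> carrier R" "x \<notin> Units R"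
  obtains u i where "u \<in> Units R" "0 < i" "i \<le> k" "x = u \<otimes> p [^] (i::nat)"
proof -
  obtain u i where u: "u \<in> Units R" "i \<le> k" "x = u \<otimes> p [^] i" using unit_times_power[OF assms(1)] by auto
  have "0 < i" using u assms(2) by (cases i) auto
  with u show thesis by (intro that[of u i])
qed

definition lower_rel :: "'a \<times> 'a \<times> 'a \<Rightarrow> 'a \<times> 'a \<times> 'a \<Rightarrow> bool"
  where "lower_rel = (\<lambda>(a, b, c) (a', b', c'). {a, b, c} \<subseteq> carrier R \<and>
    bruhat (lower_unipotent a b c) (lower_unipotent a' b' c'))"

definition lower_rel_swap :: "'a \<times> 'a \<times> 'a \<Rightarrow> 'a \<times> 'a \<times> 'a \<Rightarrow> bool"
  where "lower_rel_swap = (\<lambda>(a, b, c) (a', b', c'). lower_rel (b, a, c) (b', a', c'))"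

lemma lower_rel_trans: "lower_rel u v \<Longrightarrow> lower_rel v w \<Longrightarrow> lower_rel u w"
  unfolding lower_rel_def using bruhat_trans[OF lower_unipotent_in_GL]
  by (cases u, cases v, cases w) (simp only: prod.case, elim conjE, intro conjI)

lemma triple_relation_lower_rel: "triple_relation R p k T lower_rel"
proof (unfold_locales)
  fix u v w assume "lower_rel u v" "lower_rel v w"
  then show "lower_rel u w" by (rule lower_rel_trans)
next
  fix a b c s t
  assume "a \<in> carrier R" "b \<in> carrier R" "c \<in> carrier R" "s \<in> Units R" "t \<in> Units R"
  then show "lower_rel (a, b, c) (s \<otimes> a, t \<otimes> b, s \<otimes> t \<otimes> c)"
    using lower_unipotent_scale[of a b c s t] by (simp add: lower_rel_def)
next
  fix a b c x y
  assume "a \<in> carrier R" "b \<in> carrier R" "c \<in> carrier R" "x \<in> carrier R" "y \<in> carrier R" "b = p \<otimes> y"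
  then show "lower_rel (a, b, c) (a \<oplus> x \<otimes> c, b, c \<otimes> (\<one> \<oplus> x \<otimes> b))"
    using lower_unipotent_shear[of a b c x y] by (simp add: lower_rel_def)
qed

lemma triple_relation_lower_rel_swap: "triple_relation R p k T lower_rel_swap"
proof (unfold_locales)
  fix u v w assume "lower_rel_swap u v" "lower_rel_swap v w"
  then show "lower_rel_swap u w"
    unfolding lower_rel_swap_def
    by (cases u, cases v, cases w) (simp only: prod.case, rule lower_rel_trans)
next
  fix a b c s t
  assume "a \<in> carrier R" "b \<in> carrier R" "c \<in> carrier R" "s \<in> Units R" "t \<in> Units R"
  then show "lower_rel_swap (a, b, c) (s \<otimes> a, t \<otimes> b, s \<otimes> t \<otimes> c)"
    using lower_unipotent_scale[of b a c t s] m_comm[OF Units_closed Units_closed, of s t]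
    by (simp add: lower_rel_def lower_rel_swap_def)
next
  fix a b c x y
  assume "a \<in> carrier R" "b \<in> carrier R" "c \<in> carrier R" "x \<in> carrier R" "y \<in> carrier R" "b = p \<otimes> y"
  then show "lower_rel_swap (a, b, c) (a \<oplus> x \<otimes> c, b, c \<otimes> (\<one> \<oplus> x \<otimes> b))"
    using lower_unipotent_shear'[of b a c x y] by (simp add: lower_rel_def lower_rel_swap_def)
qed

definition coset_reps :: "(nat \<times> nat \<Rightarrow> 'a) set"
  where "coset_reps = unit_leaves \<union> (\<lambda>(a, b, c). lower_unipotent a b c) ` triple_reps
    \<union> (\<lambda>(a, b, c). lower_unipotent b a c) ` triple_reps"

lemma covered_lower_unipotent:
  assumes c: "{a, b, c} \<subseteq> carrier R" and n: "a \<notin> Units R" "b \<notin> Units R"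
  shows "covered coset_reps (lower_unipotent a b c)"
proof -
  have ac: "a \<in> carrier R" "b \<in> carrier R" "c \<in> carrier R" using c by auto
  obtain u i where u: "u \<in> Units R" "0 < i" "i \<le> k" "a = u \<otimes> p [^] i" using nonunit_power[OF ac(1) n(1)] .
  obtain v j where v: "v \<in> Units R" "0 < j" "j \<le> k" "b = v \<otimes> p [^] j" using nonunit_power[OF ac(2) n(2)] .
  show ?thesis
  proof (cases "j \<le> i")
    case True
    obtain t where t: "t \<in> triple_reps" "lower_rel (a, b, c) t"
      using triple_relation.E_cover[OF triple_relation_lower_rel u(1) v(1) v(2) True u(3) ac(3)]
      unfolding u(4)[symmetric] v(4)[symmetric] by (elim bexE)
    obtain a' b' c' where t': "t = (a', b', c')" by (cases t)
    have "bruhat (lower_unipotent a b c) (lower_unipotent a' b' c')" using t(2) by (simp add: t' lower_rel_def)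
    moreover have "lower_unipotent a' b' c' \<in> coset_reps"
      unfolding coset_reps_def using t(1) t' by (intro UnI1 UnI2 image_eqI[of _ _ t]) simp_all
    ultimately show ?thesis by (rule coveredI)
  next
    case False
    then have ij: "i \<le> j" by simp
    obtain t where t: "t \<in> triple_reps" "lower_rel_swap (b, a, c) t"
      using triple_relation.E_cover[OF triple_relation_lower_rel_swap v(1) u(1) u(2) ij v(3) ac(3)]
      unfolding u(4)[symmetric] v(4)[symmetric] by (elim bexE)
    obtain b' a' c' where t': "t = (b', a', c')" by (cases t)
    have "bruhat (lower_unipotent a b c) (lower_unipotent a' b' c')"
      using t(2) by (simp add: t' lower_rel_def lower_rel_swap_def)
    moreover have "lower_unipotent a' b' c' \<in> coset_reps"
      unfolding coset_reps_def using t(1) t' by (intro UnI2 image_eqI[of _ _ t]) simp_all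
    ultimately show ?thesis by (rule coveredI)
  qed
qed

lemma coset_reps_cover:
  assumes "M \<in> carrier (GL 3 R)"
  shows "\<exists>N\<in>coset_reps. bruhat M N"
proof -
  obtain a b c d e f g h i where M: "{a, b, c, d, e, f, g, h, i} \<subseteq> carrier R" "M = M3 a b c d e f g h i"
    using GL3_cases[OF assms] .
  have sub: "unit_leaves \<subseteq> coset_reps" by (auto simp: coset_reps_def)
  have "g \<in> Units R \<or> h \<in> Units R \<or> i \<in> Units R" using GL3_units(4) assms unfolding M(2) .
  then consider "g \<in> Units R" | "g \<notin> Units R" "h \<in> Units R" | "g \<notin> Units R" "h \<notin> Units R" "i \<in> Units R" by argo
  then have "covered coset_reps M"
  proof cases
    case 1
    show ?thesis unfolding M(2) by (rule covered_mono[OF covered_corner_unit[OF 1] sub])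
  next
    case 2
    show ?thesis unfolding M(2) by (rule covered_mono[OF covered_bottom_middle_unit[OF 2] sub])
  next
    case 3
    show ?thesis unfolding M(2) by (rule covered_bottom_right_unit[OF 3 sub covered_lower_unipotent])
  qed
  then show ?thesis using assms unfolding covered_def by simp
qed

lemma finite_coset_reps: "finite coset_reps"
  unfolding coset_reps_def using finite_unit_leaves finite_triple_reps by simp

lemma card_T_pos: "0 < card T"
  using T_cover[OF zero_closed] T_finite by (auto simp: card_gt_0_iff)

lemma card_coset_reps: "card coset_reps \<le> 9 * (k + 1) ^ 4 * card T ^ (k div 3)"
proof -
  define n where "n = card T ^ (k div 3)"
  have n: "1 \<le> n" using card_T_pos by (simp add: n_def)
  have *: "card (\<phi> ` triple_reps) \<le> (k + 1)\<^sup>2 + (k + 1) ^ 4 * n" for \<phi> :: "'a \<times> 'a \<times> 'a \<Rightarrow> nat \<times> nat \<Rightarrow> 'a"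
    using card_image_le[OF finite_triple_reps] card_triple_reps unfolding n_def by (rule order.trans)
  have "card coset_reps \<le> card (unit_leaves \<union> (\<lambda>(a, b, c). lower_unipotent a b c) ` triple_reps)
      + card ((\<lambda>(a, b, c). lower_unipotent b a c) ` triple_reps)"
    unfolding coset_reps_def by (rule card_Un_le)
  also have "\<dots> \<le> card unit_leaves + card ((\<lambda>(a, b, c). lower_unipotent a b c) ` triple_reps)
      + card ((\<lambda>(a, b, c). lower_unipotent b a c) ` triple_reps)"
    by (intro add_mono card_Un_le order.refl)
  also have "\<dots> \<le> 5 * (k + 1)\<^sup>2 + ((k + 1)\<^sup>2 + (k + 1) ^ 4 * n) + ((k + 1)\<^sup>2 + (k + 1) ^ 4 * n)"
    by (intro add_mono card_unit_leaves *)
  also have "\<dots> = 7 * (k + 1)\<^sup>2 + 2 * ((k + 1) ^ 4 * n)" by simp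
  also have "(k + 1)\<^sup>2 \<le> (k + 1) ^ 4 * n"
  proof -
    have "(k + 1)\<^sup>2 \<le> (k + 1) ^ 4" by (rule power_increasing) simp_all
    also have "\<dots> \<le> (k + 1) ^ 4 * n" using n by simp
    finally show ?thesis .
  qed
  finally show ?thesis unfolding n_def by (simp add: mult.assoc)
qed

lemma double_cosets_upper_bound:
  "finite (double_cosets (GL 3 R) (upper_triangular_GL 3 R) (upper_triangular_GL 3 R))"
  "card (double_cosets (GL 3 R) (upper_triangular_GL 3 R) (upper_triangular_GL 3 R))
    \<le> 9 * (k + 1) ^ 4 * card T ^ (k div 3)"
  using card_double_cosets_le[OF finite_coset_reps coset_reps_cover] card_coset_reps by auto

lemma pow_annihilator:
  assumes "x \<in> carrier R" "i \<le> k" "n \<le> k - i" "p [^] (i::nat) \<otimes> x = \<zero>"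
  shows "\<exists>z\<in>carrier R. x = p [^] (n::nat) \<otimes> z"
proof -
  have "p [^] i \<otimes> x = p [^] k \<otimes> \<zero>" using assms(4) by simp
  then obtain z where z: "z \<in> carrier R" "x = p [^] (k - i) \<otimes> z"
    using pow_cancel[OF assms(1) zero_closed assms(2) order.refl] by auto
  have "x = p [^] n \<otimes> (p [^] (k - i - n) \<otimes> z)"
    using z pow_split[OF assms(3)] by (simp add: m_assoc)
  then show ?thesis using z(1) by auto
qed

text \<open>The double coset of the matrix with entries \<open>a\<^sub>2\<^sub>1 = p\<^sup>n\<close>, \<open>a\<^sub>3\<^sub>2 = u p\<^sup>n\<close>, \<open>a\<^sub>3\<^sub>1 = p\<^sup>n p\<^sup>n\<close> determines
  \<open>u\<close>, which plays the role of \<open>a\<^sub>2\<^sub>1 a\<^sub>3\<^sub>2 / a\<^sub>3\<^sub>1\<close>, modulo \<open>p\<^sup>n\<close>.\<close>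

lemma bruhat_family_inj:
  assumes n: "3 * n \<le> k" and u: "u \<in> carrier R" "u' \<in> carrier R"
    and br: "bruhat (lower_unipotent (p [^] n) (u \<otimes> p [^] n) (p [^] n \<otimes> p [^] n))
      (lower_unipotent (p [^] n) (u' \<otimes> p [^] n) (p [^] n \<otimes> p [^] n))"
  shows "\<exists>z\<in>carrier R. u = u' \<oplus> p [^] n \<otimes> z"
proof -
  interpret G: group "GL 3 R" by (rule group_GL3)
  define g where "g = p [^] n"
  have g: "g \<in> carrier R" by (simp add: g_def)
  have k: "n + n \<le> k" "n \<le> k - (n + n)" "n \<le> k" "n \<le> k - n" using n by auto
  let ?M = "lower_unipotent g (u \<otimes> g) (g \<otimes> g)" and ?N = "lower_unipotent g (u' \<otimes> g) (g \<otimes> g)"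
  have MN: "?M \<in> carrier (GL 3 R)" "?N \<in> carrier (GL 3 R)"
    using u g by (simp_all add: lower_unipotent_in_GL)
  obtain P Q where PQ: "P \<in> upper_triangular_GL 3 R" "Q \<in> upper_triangular_GL 3 R"
    "?N = P \<otimes>\<^bsub>GL 3 R\<^esub> ?M \<otimes>\<^bsub>GL 3 R\<^esub> Q"
    using br unfolding g_def[symmetric] bruhat_def by (elim bexE)
  have PQc: "P \<in> carrier (GL 3 R)" "Q \<in> carrier (GL 3 R)"
    using PQ(1,2) by (simp_all add: upper_triangular_GL_def)
  have Y: "inv\<^bsub>GL 3 R\<^esub> Q \<in> upper_triangular_GL 3 R"
    by (rule subgroup.m_inv_closed[OF subgroup_upper_triangular PQ(2)])
  have "?N \<otimes>\<^bsub>GL 3 R\<^esub> inv\<^bsub>GL 3 R\<^esub> Q = P \<otimes>\<^bsub>GL 3 R\<^esub> ?M \<otimes>\<^bsub>GL 3 R\<^esub> (Q \<otimes>\<^bsub>GL 3 R\<^esub> inv\<^bsub>GL 3 R\<^esub> Q)"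
    unfolding PQ(3) using PQc MN(1) by (simp only: G.m_assoc G.m_closed G.inv_closed)
  also have "\<dots> = P \<otimes>\<^bsub>GL 3 R\<^esub> ?M" unfolding G.r_inv[OF PQc(2)] using PQc MN(1) by (intro G.r_one G.m_closed)
  finally have eq: "?N \<otimes>\<^bsub>mat_monoid 3 R\<^esub> inv\<^bsub>GL 3 R\<^esub> Q = P \<otimes>\<^bsub>mat_monoid 3 R\<^esub> ?M" unfolding mult_GL .
  obtain x11 x12 x13 x22 x23 x33 where xc: "{x11, x12, x13, x22, x23, x33} \<subseteq> carrier R" "x11 \<in> Units R"
    and x: "P = M3 x11 x12 x13 \<zero> x22 x23 \<zero> \<zero> x33"
    using upper_triangular_cases[OF PQ(1)] .
  obtain y11 y12 y13 y22 y23 y33 where yc: "{y11, y12, y13, y22, y23, y33} \<subseteq> carrier R" "y11 \<in> Units R"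
    and y: "inv\<^bsub>GL 3 R\<^esub> Q = M3 y11 y12 y13 \<zero> y22 y23 \<zero> \<zero> y33"
    using upper_triangular_cases[OF Y] .
  have c: "x22 \<in> carrier R" "x23 \<in> carrier R" "x33 \<in> carrier R" "y11 \<in> carrier R" "y12 \<in> carrier R" "y22 \<in> carrier R"
    using xc yc by auto
  have eqs: "g \<otimes> g \<otimes> y11 = x33 \<otimes> (g \<otimes> g)" "g \<otimes> y11 = x22 \<otimes> g \<oplus> x23 \<otimes> (g \<otimes> g)"
    "g \<otimes> g \<otimes> y12 \<oplus> u' \<otimes> g \<otimes> y22 = x33 \<otimes> (u \<otimes> g)" "g \<otimes> y12 \<oplus> y22 = x22 \<oplus> x23 \<otimes> (u \<otimes> g)"
    using eq xc(1) yc(1) u g unfolding x y by (auto simp: mat3_mult M3_eq_iff)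
  have "p [^] (n + n) \<otimes> (x33 \<ominus> y11) = \<zero>"
  proof -
    have "g \<otimes> g \<otimes> (x33 \<ominus> y11) = x33 \<otimes> (g \<otimes> g) \<ominus> g \<otimes> g \<otimes> y11" using g c by algebra
    then show ?thesis unfolding eqs(1) using g c by (simp add: g_def nat_pow_mult[symmetric] minus_eq r_neg)
  qed
  then obtain z1 where z1: "z1 \<in> carrier R" "x33 \<ominus> y11 = g \<otimes> z1"
    using pow_annihilator[OF _ k(1,2), of "x33 \<ominus> y11"] c unfolding g_def by auto
  have "p [^] n \<otimes> (x22 \<oplus> x23 \<otimes> g \<ominus> y11) = \<zero>"
  proof -
    have "g \<otimes> (x22 \<oplus> x23 \<otimes> g \<ominus> y11) = (x22 \<otimes> g \<oplus> x23 \<otimes> (g \<otimes> g)) \<ominus> g \<otimes> y11" using g c by algebra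
    then show ?thesis unfolding eqs(2) using g c by (simp add: g_def minus_eq r_neg)
  qed
  then obtain z2 where z2: "z2 \<in> carrier R" "x22 \<oplus> x23 \<otimes> g \<ominus> y11 = g \<otimes> z2"
    using pow_annihilator[OF _ k(3,4), of "x22 \<oplus> x23 \<otimes> g \<ominus> y11"] c g unfolding g_def by auto
  have "p [^] n \<otimes> (x33 \<otimes> u \<ominus> g \<otimes> y12 \<ominus> u' \<otimes> y22) = \<zero>"
  proof -
    have "g \<otimes> (x33 \<otimes> u \<ominus> g \<otimes> y12 \<ominus> u' \<otimes> y22) = x33 \<otimes> (u \<otimes> g) \<ominus> (g \<otimes> g \<otimes> y12 \<oplus> u' \<otimes> g \<otimes> y22)"
      using g c u by algebra
    then show ?thesis unfolding eqs(3) using g c u by (simp add: g_def minus_eq r_neg)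
  qed
  then obtain z3 where z3: "z3 \<in> carrier R" "x33 \<otimes> u \<ominus> g \<otimes> y12 \<ominus> u' \<otimes> y22 = g \<otimes> z3"
    using pow_annihilator[OF _ k(3,4), of "x33 \<otimes> u \<ominus> g \<otimes> y12 \<ominus> u' \<otimes> y22"] c g u unfolding g_def by auto
  have x33: "x33 = y11 \<oplus> g \<otimes> z1" unfolding z1(2)[symmetric] using c by algebra
  have x22: "x22 = y11 \<oplus> g \<otimes> z2 \<ominus> x23 \<otimes> g" unfolding z2(2)[symmetric] using c g by algebra
  have "y22 = (g \<otimes> y12 \<oplus> y22) \<ominus> g \<otimes> y12" using c g by algebra
  also have "\<dots> = x22 \<oplus> x23 \<otimes> (u \<otimes> g) \<ominus> g \<otimes> y12" unfolding eqs(4) ..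
  finally have y22: "y22 = x22 \<oplus> x23 \<otimes> (u \<otimes> g) \<ominus> g \<otimes> y12" .
  define w where "w = z3 \<ominus> z1 \<otimes> u \<oplus> y12 \<oplus> u' \<otimes> (z2 \<ominus> x23 \<oplus> x23 \<otimes> u \<ominus> y12)"
  have w: "w \<in> carrier R" using z1 z2 z3 c u by (simp add: w_def)
  have "g \<otimes> w = g \<otimes> z3 \<ominus> g \<otimes> z1 \<otimes> u \<oplus> g \<otimes> y12 \<oplus> u' \<otimes> (g \<otimes> z2 \<ominus> x23 \<otimes> g \<oplus> x23 \<otimes> (u \<otimes> g) \<ominus> g \<otimes> y12)"
    unfolding w_def using z1(1) z2(1) z3(1) c g u by algebra
  also have "\<dots> = (x33 \<otimes> u \<ominus> g \<otimes> y12 \<ominus> u' \<otimes> y22) \<ominus> (x33 \<ominus> y11) \<otimes> u \<oplus> g \<otimes> y12 \<oplus> u' \<otimes> (y22 \<ominus> y11)"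
  proof -
    have "y22 \<ominus> y11 = g \<otimes> z2 \<ominus> x23 \<otimes> g \<oplus> x23 \<otimes> (u \<otimes> g) \<ominus> g \<otimes> y12"
      unfolding y22 x22 using z2(1) c g u by algebra
    then show ?thesis unfolding z3(2) z1(2) by simp
  qed
  also have "\<dots> = y11 \<otimes> (u \<ominus> u')" using c g u by algebra
  finally have gw: "g \<otimes> w = y11 \<otimes> (u \<ominus> u')" .
  have yi: "inv y11 \<in> carrier R" using yc(2) by auto
  have "u = u' \<oplus> (u \<ominus> u')" using u by algebra
  also have "u \<ominus> u' = inv y11 \<otimes> (y11 \<otimes> (u \<ominus> u'))" using inverse_cancel[OF yc(2)] u by simp
  also have "\<dots> = g \<otimes> (inv y11 \<otimes> w)" unfolding gw[symmetric] using g w yi by algebra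
  finally show ?thesis unfolding g_def using w yi by (intro bexI[of _ "inv y11 \<otimes> w"]) simp_all
qed

lemma double_cosets_lower_bound:
  "card T ^ (k div 3) \<le> card (double_cosets (GL 3 R) (upper_triangular_GL 3 R) (upper_triangular_GL 3 R))"
proof -
  define n where "n = k div 3"
  have n: "3 * n \<le> k" "n \<le> k" by (auto simp: n_def)
  have "card (T_mod n) \<le> card (double_cosets (GL 3 R) (upper_triangular_GL 3 R) (upper_triangular_GL 3 R))"
  proof (rule card_double_cosets_ge[OF double_cosets_upper_bound(1)])
    fix u assume "u \<in> T_mod n"
    then show "lower_unipotent (p [^] n) (u \<otimes> p [^] n) (p [^] n \<otimes> p [^] n) \<in> carrier (GL 3 R)"
      using T_mod_closed by (intro lower_unipotent_in_GL) auto
  next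
    fix u u' assume u: "u \<in> T_mod n" "u' \<in> T_mod n"
      and b: "bruhat (lower_unipotent (p [^] n) (u \<otimes> p [^] n) (p [^] n \<otimes> p [^] n))
        (lower_unipotent (p [^] n) (u' \<otimes> p [^] n) (p [^] n \<otimes> p [^] n))"
    have "\<exists>z\<in>carrier R. u = u' \<oplus> p [^] n \<otimes> z"
      using u T_mod_closed by (intro bruhat_family_inj[OF n(1) _ _ b]) auto
    then obtain z where "z \<in> carrier R" "u = u' \<oplus> p [^] n \<otimes> z" by (elim bexE)
    then show "u = u'" by (rule T_mod_unique[OF n(2) u])
  qed
  then show ?thesis unfolding n_def[symmetric] using card_T_mod[OF n(2)] by simp
qed

end

section \<open>Quotients of a local principal ideal ring\<close>

lemma (in cring) nonunit_in_maximalideal: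
  assumes x: "x \<in> carrier R" "x \<notin> Units R"
  shows "\<exists>M. maximalideal M R \<and> x \<in> M"
proof -
  define \<A> where "\<A> = {I. ideal I R \<and> PIdl x \<subseteq> I \<and> \<one> \<notin> I}"
  have carrier_iff: "\<one> \<in> I \<longleftrightarrow> I = carrier R" if "ideal I R" for I
    using ideal.one_imp_carrier[OF that] by auto
  have "PIdl x \<noteq> carrier R" using ideal_eq_carrier_iff[OF x(1)] x(2) by simp
  then have mem: "PIdl x \<in> \<A>"
    unfolding \<A>_def using cgenideal_ideal[OF x(1)] carrier_iff by simp
  have "\<exists>M\<in>\<A>. \<forall>J\<in>\<A>. M \<subseteq> J \<longrightarrow> J = M"
  proof (rule subset_Zorn_nonempty)
    show "\<A> \<noteq> {}" using mem by auto
  next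
    fix \<C> assume C: "\<C> \<noteq> {}" "subset.chain \<A> \<C>"
    then have sub: "\<C> \<subseteq> \<A>" by (simp add: pred_on.chain_def)
    have "subset.chain {I. ideal I R} \<C>"
      using C(2) unfolding pred_on.chain_def \<A>_def by auto
    from chain_Union_is_ideal[OF this] C(1) have "ideal (\<Union>\<C>) R" by simp
    moreover have "PIdl x \<subseteq> \<Union>\<C>"
    proof -
      obtain I where "I \<in> \<C>" using C(1) by auto
      then show ?thesis using sub unfolding \<A>_def by auto
    qed
    moreover have "\<one> \<notin> \<Union>\<C>" using sub unfolding \<A>_def by auto
    ultimately show "\<Union>\<C> \<in> \<A>" unfolding \<A>_def by simp
  qed
  then obtain M where M: "M \<in> \<A>" "\<And>J. J \<in> \<A> \<Longrightarrow> M \<subseteq> J \<Longrightarrow> J = M" by auto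
  have ideal: "ideal M R" and sub: "PIdl x \<subseteq> M" and one: "\<one> \<notin> M" using M(1) by (auto simp: \<A>_def)
  have "maximalideal M R"
  proof (rule maximalidealI[OF ideal])
    show "carrier R \<noteq> M" using one by auto
    fix J assume J: "ideal J R" "M \<subseteq> J" "J \<subseteq> carrier R"
    show "J = M \<or> J = carrier R"
    proof (cases "\<one> \<in> J")
      case True
      then show ?thesis using carrier_iff[OF J(1)] by simp
    next
      case False
      then have "J \<in> \<A>" using J sub by (auto simp: \<A>_def)
      then show ?thesis using M(2) J(2) by simp
    qed
  qed
  then show ?thesis using sub cgenideal_self[OF x(1)] by auto
qed

context local_principal_ideal_ring
begin

lemma maximalideal_max_ideal: "maximalideal (max_ideal A) A"
  unfolding max_ideal_def by (rule theI'[OF unique_maximalideal])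

lemma max_ideal_generator:
  obtains x where "x \<in> carrier A" "max_ideal A = PIdl\<^bsub>A\<^esub> x"
proof -
  have "ideal (max_ideal A) A" using maximalideal.axioms(1)[OF maximalideal_max_ideal] .
  then have "principalideal (max_ideal A) A" by (rule all_ideals_principal)
  from principalideal.generate[OF this]
  obtain x where "x \<in> carrier A" "max_ideal A = Idl\<^bsub>A\<^esub> {x}" by (elim bexE)
  then show thesis using cgenideal_eq_genideal by (intro that[of x]) simp_all
qed

lemma unit_if_not_in_max_ideal:
  assumes "x \<in> carrier A" "x \<notin> max_ideal A"
  shows "x \<in> Units A"
proof (rule ccontr)
  assume "x \<notin> Units A"
  then obtain M where M: "maximalideal M A" "x \<in> M" using nonunit_in_maximalideal[OF assms(1)] by auto
  have "M = max_ideal A" using unique_maximalideal M(1) maximalideal_max_ideal by auto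
  then show False using M(2) assms(2) by simp
qed

lemma one_not_in_max_ideal: "\<one> \<notin> max_ideal A"
  using maximalideal.I_notcarr[OF maximalideal_max_ideal]
    ideal.one_imp_carrier[OF maximalideal.axioms(1)[OF maximalideal_max_ideal]] by auto

lemma max_ideal_power_eq:
  assumes x: "x \<in> carrier A" "max_ideal A = PIdl\<^bsub>A\<^esub> x"
  shows "max_ideal_power A n = PIdl\<^bsub>A\<^esub> (x [^] n)"
proof (induction n)
  case 0
  have "PIdl\<^bsub>A\<^esub> \<one> = carrier A" using ideal_eq_carrier_iff[OF one_closed] by simp
  then show ?case by (simp add: max_ideal_power_def ideals_set_def nat_pow_def)
next
  case (Suc n)
  have c: "x [^] n \<in> carrier A" using x by simp
  have "max_ideal_power A (Suc n) = max_ideal_power A n \<cdot>\<^bsub>A\<^esub> max_ideal A"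
    by (simp add: max_ideal_power_def ideals_set_def nat_pow_def)
  also have "\<dots> = Idl\<^bsub>A\<^esub> (PIdl\<^bsub>A\<^esub> (x [^] n) <#>\<^bsub>A\<^esub> PIdl\<^bsub>A\<^esub> x)"
    unfolding Suc x(2) by (rule ideal_prod_eq_genideal[OF cgenideal_ideal[OF c] cgenideal_ideal[OF x(1)]])
  also have "\<dots> = Idl\<^bsub>A\<^esub> (PIdl\<^bsub>A\<^esub> (x [^] Suc n))"
    unfolding cgenideal_prod[OF c x(1)] by simp
  also have "\<dots> = PIdl\<^bsub>A\<^esub> (x [^] Suc n)"
  proof
    have i: "ideal (PIdl\<^bsub>A\<^esub> (x [^] Suc n)) A" using x by (intro cgenideal_ideal) simp
    show "Idl\<^bsub>A\<^esub> (PIdl\<^bsub>A\<^esub> (x [^] Suc n)) \<subseteq> PIdl\<^bsub>A\<^esub> (x [^] Suc n)" by (rule genideal_minimal[OF i order.refl])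
    show "PIdl\<^bsub>A\<^esub> (x [^] Suc n) \<subseteq> Idl\<^bsub>A\<^esub> (PIdl\<^bsub>A\<^esub> (x [^] Suc n))"
      by (rule genideal_self) (use i in \<open>auto dest: ideal.Icarr\<close>)
  qed
  finally show ?case .
qed

lemma mem_PIdl_iff: "y \<in> PIdl\<^bsub>A\<^esub> x \<longleftrightarrow> (\<exists>z\<in>carrier A. y = z \<otimes> x)"
  unfolding cgenideal_def by auto

lemma power_not_in_max_ideal_power:
  assumes x: "x \<in> carrier A" "max_ideal A = PIdl\<^bsub>A\<^esub> x" and k: "enat k \<le> local_ring_length A" and j: "j < k"
  shows "x [^] j \<notin> PIdl\<^bsub>A\<^esub> (x [^] k)"
proof
  assume "x [^] j \<in> PIdl\<^bsub>A\<^esub> (x [^] k)"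
  then obtain z where z: "z \<in> carrier A" "x [^] j = z \<otimes> x [^] k" by (auto simp: mem_PIdl_iff)
  obtain m where m: "k = j + Suc m" using less_imp_Suc_add[OF j] by auto
  define g h where "g = x [^] j" and "h = x [^] m"
  have c: "g \<in> carrier A" "h \<in> carrier A" using x by (auto simp: g_def h_def)
  have g: "g = z \<otimes> (g \<otimes> (h \<otimes> x))"
    using z(2) x(1) unfolding g_def h_def m by (simp add: nat_pow_mult[symmetric] m_assoc)
  define v where "v = \<one> \<ominus> z \<otimes> h \<otimes> x"
  have vc: "v \<in> carrier A" using z c x by (simp add: v_def)
  have "v \<notin> max_ideal A"
  proof
    assume "v \<in> max_ideal A"
    then obtain y where y: "y \<in> carrier A" "v = y \<otimes> x" unfolding x(2) by (auto simp: mem_PIdl_iff)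
    have "\<one> = v \<oplus> z \<otimes> h \<otimes> x" unfolding v_def using z(1) c x(1) by algebra
    also have "\<dots> = (y \<oplus> z \<otimes> h) \<otimes> x" unfolding y(2) using y(1) z(1) c x(1) by algebra
    finally have "\<one> \<in> max_ideal A" unfolding x(2) mem_PIdl_iff using y(1) z(1) c
      by (intro bexI[of _ "y \<oplus> z \<otimes> h"]) simp_all
    then show False using one_not_in_max_ideal by simp
  qed
  then have v: "v \<in> Units A" using unit_if_not_in_max_ideal[OF vc] by simp
  then have vi: "inv v \<in> carrier A" by simp
  have "g \<otimes> v = g \<ominus> z \<otimes> (g \<otimes> (h \<otimes> x))" unfolding v_def using z(1) c x(1) by algebra
  also have "\<dots> = \<zero>" unfolding g[symmetric] using c by (simp add: minus_eq r_neg)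
  finally have gv: "g \<otimes> v = \<zero>" .
  have "g = (g \<otimes> v) \<otimes> inv v" using v c vi vc by (simp add: m_assoc)
  then have g0: "x [^] j = \<zero>" using gv vi unfolding g_def by simp
  have "j \<noteq> 0"
  proof
    assume "j = 0"
    then have "\<one> = \<zero>" using g0 by simp
    then show False using one_not_in_max_ideal additive_subgroup.zero_closed[OF ideal.axioms(1)]
      maximalideal.axioms(1)[OF maximalideal_max_ideal] by metis
  qed
  then have "0 < j" by simp
  have "PIdl\<^bsub>A\<^esub> \<zero> = {\<zero>}"
    using cgenideal_self[OF zero_closed] by (auto simp: mem_PIdl_iff)
  then have pj: "max_ideal_power A j = {\<zero>}" using max_ideal_power_eq[OF x] g0 by simp
  have "local_ring_length A = enat (LEAST m. m > 0 \<and> max_ideal_power A m = {\<zero>})"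
    unfolding local_ring_length_def using pj \<open>0 < j\<close> by auto
  also have "\<dots> \<le> enat j" using pj \<open>0 < j\<close> by (simp add: Least_le)
  finally show False using k j by (meson enat_ord_simps(1) leD order.trans)
qed

lemma ex_residue_reps:
  obtains S where "S \<subseteq> carrier A" "bij_betw (\<lambda>s. max_ideal A +>\<^bsub>A\<^esub> s) S (carrier (A Quot max_ideal A))"
proof -
  define r where "r = (\<lambda>C. SOME s. s \<in> carrier A \<and> C = max_ideal A +>\<^bsub>A\<^esub> s)"
  have r: "r C \<in> carrier A \<and> C = max_ideal A +>\<^bsub>A\<^esub> r C" if "C \<in> carrier (A Quot max_ideal A)" for C
  proof -
    have "\<exists>s. s \<in> carrier A \<and> C = max_ideal A +>\<^bsub>A\<^esub> s"
      using that by (auto simp: FactRing_def A_RCOSETS_def')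
    then show ?thesis unfolding r_def by (rule someI_ex)
  qed
  show thesis
  proof (rule that)
    show "r ` carrier (A Quot max_ideal A) \<subseteq> carrier A" using r by auto
    show "bij_betw (\<lambda>s. max_ideal A +>\<^bsub>A\<^esub> s) (r ` carrier (A Quot max_ideal A)) (carrier (A Quot max_ideal A))"
      by (rule bij_betw_byWitness[where f' = r]) (use r in auto)
  qed
qed

lemma quotient_finite_chain_ring:
  assumes fin: "finite (carrier (A Quot max_ideal A))"
    and k: "0 < k" "enat k \<le> local_ring_length A"
  shows "\<exists>p T. finite_chain_ring (A Quot max_ideal_power A k) p k T \<and> card T = card (carrier (A Quot max_ideal A))"
proof -
  obtain x where x: "x \<in> carrier A" "max_ideal A = PIdl\<^bsub>A\<^esub> x" using max_ideal_generator .
  define J where "J = PIdl\<^bsub>A\<^esub> (x [^] k)"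
  have pow: "max_ideal_power A k = J" unfolding J_def by (rule max_ideal_power_eq[OF x])
  have J: "ideal J A" unfolding J_def using x by (intro cgenideal_ideal) simp
  have M: "ideal (max_ideal A) A" using maximalideal.axioms(1)[OF maximalideal_max_ideal] .
  have JM: "J \<subseteq> max_ideal A"
  proof
    fix y assume "y \<in> J"
    then obtain z where z: "z \<in> carrier A" "y = z \<otimes> x [^] k" by (auto simp: J_def mem_PIdl_iff)
    obtain m where "k = Suc m" using k(1) by (cases k) auto
    then have "y = (z \<otimes> x [^] m) \<otimes> x" using z x(1) by (simp add: m_assoc)
    then show "y \<in> max_ideal A" unfolding x(2) mem_PIdl_iff using z(1) x(1) by (intro bexI[of _ "z \<otimes> x [^] m"]) simp_all
  qed
  define Q where "Q = A Quot J"
  define \<phi> where "\<phi> = (\<lambda>a. J +>\<^bsub>A\<^esub> a)"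
  interpret h: ring_hom_cring A Q \<phi>
    unfolding Q_def \<phi>_def using ideal.rcos_ring_hom_cring[OF J is_cring] .
  have eq_iff: "\<phi> a = \<phi> b \<longleftrightarrow> a \<ominus> b \<in> J" if "a \<in> carrier A" "b \<in> carrier A" for a b
    unfolding \<phi>_def using quotient_eq_iff_same_a_r_cos[OF J that] by simp
  have zero_iff: "\<phi> a = \<zero>\<^bsub>Q\<^esub> \<longleftrightarrow> a \<in> J" if "a \<in> carrier A" for a
    using eq_iff[OF that zero_closed] that by (simp add: minus_eq)
  have surj: "\<exists>a\<in>carrier A. y = \<phi> a" if "y \<in> carrier Q" for y
    using that by (auto simp: Q_def \<phi>_def FactRing_def A_RCOSETS_def')
  have unit: "\<phi> u \<in> Units Q" if u: "u \<in> Units A" for u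
  proof -
    have uc: "u \<in> carrier A" "inv u \<in> carrier A" using u by auto
    have "\<phi> u \<otimes>\<^bsub>Q\<^esub> \<phi> (inv u) = \<one>\<^bsub>Q\<^esub>" "\<phi> (inv u) \<otimes>\<^bsub>Q\<^esub> \<phi> u = \<one>\<^bsub>Q\<^esub>"
      using u uc by (simp_all add: h.hom_mult[symmetric])
    then show ?thesis using uc by (auto simp: Units_def)
  qed
  obtain S where S: "S \<subseteq> carrier A" "bij_betw (\<lambda>s. max_ideal A +>\<^bsub>A\<^esub> s) S (carrier (A Quot max_ideal A))"
    using ex_residue_reps .
  have S_unique: "s = t" if "s \<in> S" "t \<in> S" "s \<ominus> t \<in> max_ideal A" for s t
  proof -
    have "max_ideal A +>\<^bsub>A\<^esub> s = max_ideal A +>\<^bsub>A\<^esub> t"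
      using quotient_eq_iff_same_a_r_cos[OF M, of s t] that S(1) by auto
    then show ?thesis using S(2) that unfolding bij_betw_def inj_on_def by simp
  qed
  have finS: "finite S" using bij_betw_finite[OF S(2)] fin by simp
  have inj: "inj_on \<phi> S"
  proof (rule inj_onI)
    fix s t assume st: "s \<in> S" "t \<in> S" "\<phi> s = \<phi> t"
    then have "s \<ominus> t \<in> J" using eq_iff S(1) by auto
    then show "s = t" using S_unique[OF st(1,2)] JM by auto
  qed
  have "finite_chain_ring Q (\<phi> x) k (\<phi> ` S)"
  proof (intro finite_chain_ring.intro finite_chain_ring_axioms.intro)
    show "cring Q" by (rule h.S.is_cring)
    show "\<phi> x \<in> carrier Q" using x by simp
    show "0 < k" by fact
    have phi_pow: "\<phi> x [^]\<^bsub>Q\<^esub> (n::nat) = \<phi> (x [^] n)" for n using x(1) by simp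
    have "x [^] k \<in> J" unfolding J_def using x(1) by (intro cgenideal_self) simp
    then show "\<phi> x [^]\<^bsub>Q\<^esub> k = \<zero>\<^bsub>Q\<^esub>" unfolding phi_pow using zero_iff[of "x [^] k"] x(1) by simp
    fix j assume "j < k"
    then have "x [^] j \<notin> J" unfolding J_def by (rule power_not_in_max_ideal_power[OF x k(2)])
    then show "\<phi> x [^]\<^bsub>Q\<^esub> j \<noteq> \<zero>\<^bsub>Q\<^esub>" unfolding phi_pow using zero_iff[of "x [^] j"] x(1) by simp
  next
    have phi_pow: "\<phi> x [^]\<^bsub>Q\<^esub> (n::nat) = \<phi> (x [^] n)" for n using x(1) by simp
    fix y assume "y \<in> carrier Q"
    then obtain a where a: "a \<in> carrier A" "y = \<phi> a" using surj by auto
    show "\<exists>u\<in>Units Q. \<exists>i\<le>k. y = u \<otimes>\<^bsub>Q\<^esub> \<phi> x [^]\<^bsub>Q\<^esub> i"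
    proof (cases "a \<in> J")
      case True
      then have "y = \<one>\<^bsub>Q\<^esub> \<otimes>\<^bsub>Q\<^esub> \<phi> x [^]\<^bsub>Q\<^esub> k"
        unfolding phi_pow a(2) using zero_iff[OF a(1)] zero_iff[of "x [^] k"] x(1) cgenideal_self[of "x [^] k"]
        unfolding J_def by simp
      then show ?thesis by (intro bexI[of _ "\<one>\<^bsub>Q\<^esub>"] exI[of _ k]) simp_all
    next
      case False
      define P where "P = (\<lambda>n::nat. a \<in> PIdl\<^bsub>A\<^esub> (x [^] n))"
      have "P 0" unfolding P_def using ideal_eq_carrier_iff[OF one_closed] a(1) by simp
      moreover have "\<not> P k" using False unfolding P_def J_def .
      ultimately obtain n where n: "n < k" "P n" "\<not> P (Suc n)"
        using ex_least_nat_less[of "\<lambda>n. \<not> P n" k] by auto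
      obtain u where u: "u \<in> carrier A" "a = u \<otimes> x [^] n" using n(2) by (auto simp: P_def mem_PIdl_iff)
      have "u \<notin> max_ideal A"
      proof
        assume "u \<in> max_ideal A"
        then obtain z where z: "z \<in> carrier A" "u = z \<otimes> x" unfolding x(2) by (auto simp: mem_PIdl_iff)
        have "a = z \<otimes> x [^] Suc n" unfolding u(2) z(2) using z(1) x(1) by (simp add: m_ac)
        then show False using n(3) z(1) unfolding P_def mem_PIdl_iff by auto
      qed
      then have "\<phi> u \<in> Units Q" using unit unit_if_not_in_max_ideal[OF u(1)] by simp
      moreover have "y = \<phi> u \<otimes>\<^bsub>Q\<^esub> \<phi> x [^]\<^bsub>Q\<^esub> n" unfolding phi_pow a(2) u(2) using u(1) x(1) by simp
      ultimately show ?thesis using n(1) by (intro bexI[of _ "\<phi> u"] exI[of _ n]) simp_all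
    qed
    have "max_ideal A +>\<^bsub>A\<^esub> a \<in> carrier (A Quot max_ideal A)"
      using a(1) by (auto simp: FactRing_def A_RCOSETS_def')
    then obtain s where s: "s \<in> S" "max_ideal A +>\<^bsub>A\<^esub> a = max_ideal A +>\<^bsub>A\<^esub> s"
      using S(2) unfolding bij_betw_def by auto
    have sc: "s \<in> carrier A" using s S(1) by auto
    have "a \<ominus> s \<in> max_ideal A" using quotient_eq_iff_same_a_r_cos[OF M a(1) sc] s(2) by simp
    then obtain z where z: "z \<in> carrier A" "a \<ominus> s = z \<otimes> x" unfolding x(2) by (auto simp: mem_PIdl_iff)
    have "a = s \<oplus> (a \<ominus> s)" using a(1) sc by algebra
    then have "a = s \<oplus> x \<otimes> z" unfolding z(2) using z(1) x(1) by (simp add: m_comm)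
    then have "y = \<phi> s \<oplus>\<^bsub>Q\<^esub> \<phi> x \<otimes>\<^bsub>Q\<^esub> \<phi> z" unfolding a(2) using sc x(1) z(1) by simp
    then show "\<exists>t\<in>\<phi> ` S. \<exists>z\<in>carrier Q. y = t \<oplus>\<^bsub>Q\<^esub> \<phi> x \<otimes>\<^bsub>Q\<^esub> z"
      using s(1) z(1) by (intro bexI[of _ "\<phi> s"] bexI[of _ "\<phi> z"]) simp_all
  next
    show "finite (\<phi> ` S)" using finS by simp
    show "\<phi> ` S \<subseteq> carrier Q" using S(1) by auto
  next
    fix s' t' z' assume st: "s' \<in> \<phi> ` S" "t' \<in> \<phi> ` S" "z' \<in> carrier Q" "s' = t' \<oplus>\<^bsub>Q\<^esub> \<phi> x \<otimes>\<^bsub>Q\<^esub> z'"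
    obtain s where s: "s \<in> S" "s' = \<phi> s" using st(1) by auto
    obtain t where t: "t \<in> S" "t' = \<phi> t" using st(2) by auto
    obtain z where z: "z \<in> carrier A" "z' = \<phi> z" using surj[OF st(3)] by auto
    have c: "s \<in> carrier A" "t \<in> carrier A" "z \<in> carrier A" "x \<in> carrier A" using s t z S(1) x by auto
    have "\<phi> s = \<phi> (t \<oplus> x \<otimes> z)" using st(4) c unfolding s(2) t(2) z(2) by simp
    then have "s \<ominus> (t \<oplus> x \<otimes> z) \<in> J" using eq_iff[of s "t \<oplus> x \<otimes> z"] c by simp
    then have "s \<ominus> (t \<oplus> x \<otimes> z) \<in> max_ideal A" using JM by auto
    then obtain w where w: "w \<in> carrier A" "s \<ominus> (t \<oplus> x \<otimes> z) = w \<otimes> x"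
      unfolding x(2) by (auto simp: mem_PIdl_iff)
    have "s \<ominus> t = (s \<ominus> (t \<oplus> x \<otimes> z)) \<oplus> x \<otimes> z" using c by algebra
    also have "\<dots> = (w \<oplus> z) \<otimes> x" unfolding w(2) using w(1) c by algebra
    finally have "s \<ominus> t \<in> max_ideal A" unfolding x(2) mem_PIdl_iff using w(1) c by auto
    then show "s' = t'" using S_unique[OF s(1) t(1)] s(2) t(2) by simp
  qed
  moreover have "card (\<phi> ` S) = card (carrier (A Quot max_ideal A))"
    using card_image[OF inj] bij_betw_same_card[OF S(2)] by simp
  ultimately show ?thesis unfolding pow Q_def[symmetric] by (intro exI conjI)
qed

end

theorem corollary4p3:
  fixes A :: "('a, 'm) ring_scheme" and q :: nat
  assumes "local_principal_ideal_ring A"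
    and "finite (carrier (A Quot max_ideal A))"
    and "card (carrier (A Quot max_ideal A)) = q"
  shows "\<exists>p1 p2 :: real poly.
    (\<forall>n::nat. n > 0 \<longrightarrow> poly p1 (real n) > 0 \<and> poly p2 (real n) > 0) \<and>
    (\<forall>k::nat. k > 0 \<and> enat k \<le> local_ring_length A \<longrightarrow>
      (let A\<^sub>k = A Quot max_ideal_power A k;
           B = upper_triangular_GL 3 A\<^sub>k;
           N = real (card (double_cosets (GL 3 A\<^sub>k) B B))
       in poly p1 (real k) * real q ^ nat \<lfloor>real k / 3\<rfloor> < N \<and>
          N < poly p2 (real k) * real q ^ nat \<lceil>real k / 3\<rceil>))"
proof -
  define p1 p2 :: "real poly" where "p1 = [:1 / 2:]" and "p2 = smult 10 ([:1, 1:] ^ 4)"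
  have pos: "poly p1 (real n) > 0 \<and> poly p2 (real n) > 0" for n
    by (simp add: p1_def p2_def zero_less_power)
  have bounds: "poly p1 (real k) * real q ^ nat \<lfloor>real k / 3\<rfloor> < real N \<and>
      real N < poly p2 (real k) * real q ^ nat \<lceil>real k / 3\<rceil>"
    if k: "k > 0" "enat k \<le> local_ring_length A"
      and N: "N = card (double_cosets (GL 3 (A Quot max_ideal_power A k))
        (upper_triangular_GL 3 (A Quot max_ideal_power A k)) (upper_triangular_GL 3 (A Quot max_ideal_power A k)))"
    for k N
  proof -
    obtain p T where fcr: "finite_chain_ring (A Quot max_ideal_power A k) p k T" and T: "card T = q"
      using local_principal_ideal_ring.quotient_finite_chain_ring[OF assms(1,2) k] assms(3) by auto
    have q: "0 < q" using finite_chain_ring.card_T_pos[OF fcr] T by simp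
    have le: "N \<le> 9 * (k + 1) ^ 4 * q ^ (k div 3)" and ge: "q ^ (k div 3) \<le> N"
      using finite_chain_ring.double_cosets_upper_bound(2)[OF fcr]
        finite_chain_ring.double_cosets_lower_bound[OF fcr] unfolding T N .
    have floor: "nat \<lfloor>real k / 3\<rfloor> = k div 3"
      using floor_divide_of_nat_eq[of k 3, where 'a = real] by (simp add: nat_div_distrib)
    have "\<lfloor>real k / 3\<rfloor> \<le> \<lceil>real k / 3\<rceil>" by (rule floor_le_ceiling)
    then have exponent: "k div 3 \<le> nat \<lceil>real k / 3\<rceil>" unfolding floor[symmetric] by (rule nat_mono)
    have "real N > 1 / 2 * real q ^ (k div 3)"
    proof -
      have "1 / 2 * real q ^ (k div 3) < real q ^ (k div 3)" using q by simp
      also have "\<dots> \<le> real N" using ge by (metis of_nat_le_iff of_nat_power)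
      finally show ?thesis .
    qed
    moreover have "real N < 10 * (1 + real k) ^ 4 * real q ^ nat \<lceil>real k / 3\<rceil>"
    proof -
      have "real N \<le> real (9 * (k + 1) ^ 4 * q ^ (k div 3))" using le by (rule of_nat_mono)
      also have "\<dots> = 9 * (1 + real k) ^ 4 * real q ^ (k div 3)" by (simp add: add.commute)
      also have "\<dots> < 10 * (1 + real k) ^ 4 * real q ^ (k div 3)" using q by simp
      also have "\<dots> \<le> 10 * (1 + real k) ^ 4 * real q ^ nat \<lceil>real k / 3\<rceil>"
        using q exponent by (intro mult_left_mono power_increasing) simp_all
      finally show ?thesis .
    qed
    ultimately show ?thesis unfolding floor by (simp add: p1_def p2_def)
  qed
  show ?thesis
    unfolding Let_def using pos bounds by (intro exI[of _ p1] exI[of _ p2]) simp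
qed

end
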